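(* For every fixed nonnegative integer $m$, $$(-1)^{m+n+1}\bigl(N_{C_1}(m,n)-N_{C_1}(m+1,n)\bigr)>0$$ for all large enough integers $n$ (i.e. for all integers $n\ge n_0$ for some $n_0=n_0(m)$).
   Context: For $n\in\{0,1,2,\dots\}\cup\{\infty\}$ put $(a;q)_n:=\prod_{k=1}^{n}(1-aq^{k-1})$ and $(a)_n:=(a;q)_n$. The integers $N_{C_1}(m,n)$ ($m\in\mathbb{Z}$, $n\ge 0$) are defined by the generating function $$\sum_{n\ge 0}\sum_{m\in\mathbb{Z}}N_{C_1}(m,n)z^mq^n=\frac{(q;q^2)_\infty (q)_\infty}{(z)_\infty(z^{-1})_\infty}\sum_{n=1}^{\infty}\frac{q^n(z)_n(z^{-1})_n}{(q;q^2)_n(q)_n},$$ where, for each $n\geq 1$, the quotient $\frac{(z)_n(z^{-1})_n}{(z)_\infty(z^{-1})_\infty}$ is understood as $\frac{1}{(zq^n)_\infty(z^{-1}q^n)_\infty}$, expanded as a power series in $q$ with coefficients Laurent polynomials in $z$. *)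

theory Defs
  imports "HOL-Analysis.Analysis" "HOL-Library.Poly_Mapping"
begin

text \<open>
  Generating functions live in the ring of formal power series in \<open>q\<close> whose coefficients are
  Laurent polynomials in \<open>z\<close> over the integers. A Laurent polynomial is a finitely supported
  map from exponents to coefficients, multiplied by convolution. Infinite sums and products are
  taken in the library's \<open>q\<close>-adic topology on formal power series.
\<close>

type_synonym laurent_poly = "int \<Rightarrow>\<^sub>0 int"

abbreviation z_pow :: "int \<Rightarrow> laurent_poly fps" where
  "z_pow k \<equiv> fps_const (Poly_Mapping.single k 1)"

abbreviation qX :: "laurent_poly fps" where
  "qX \<equiv> fps_X"

definition qpoch :: "'a::comm_ring_1 \<Rightarrow> 'a \<Rightarrow> nat \<Rightarrow> 'a" where
  "qpoch a b n = (\<Prod>k=1..n. 1 - a * b ^ (k - 1))"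

definition qpoch_inf :: "'a \<Rightarrow> 'a \<Rightarrow> 'a::{comm_ring_1, t2_space}" where
  "qpoch_inf a b = prodinf (\<lambda>k. 1 - a * b ^ k)"

text \<open>
  Laurent polynomials are not an instance of \<^class>\<open>inverse\<close>, so neither are power series
  over them. This is the reciprocal of a power series with constant term 1, the only kind that
  is inverted below.
\<close>

definition recip :: "'a::comm_ring_1 fps \<Rightarrow> 'a fps" where
  "recip f = fps_right_inverse f 1"

text \<open>
  The quotient of \<open>(z)\<^sub>n (1/z)\<^sub>n\<close> by \<open>(z)\<^sub>\<infinity> (1/z)\<^sub>\<infinity>\<close> is entered in its cancelled form,
  the reciprocal of \<open>(z q\<^sup>n)\<^sub>\<infinity> (q\<^sup>n/z)\<^sub>\<infinity>\<close>, since \<open>(z)\<^sub>\<infinity>\<close> itself is not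
  invertible. This is also why it stands inside the sum over \<open>n\<close>.
\<close>

definition C1_term :: "nat \<Rightarrow> laurent_poly fps" where
  "C1_term n =
     qX ^ n * recip (qpoch_inf (z_pow 1 * qX ^ n) qX * qpoch_inf (z_pow (-1) * qX ^ n) qX)
            * recip (qpoch qX (qX ^ 2) n * qpoch qX qX n)"

definition C1_gf :: "laurent_poly fps" where
  "C1_gf = qpoch_inf qX (qX ^ 2) * qpoch_inf qX qX * suminf (\<lambda>n. C1_term (Suc n))"

definition N_C1 :: "int \<Rightarrow> nat \<Rightarrow> int" where
  "N_C1 m n = Poly_Mapping.lookup (fps_nth C1_gf n) m"


text \<open>
  The infinite products and the infinite sum above converge, and only series with constant term 1
  are inverted, so none of these definitions falls back on a default value.
\<close>

lemma mult_recip: "fps_nth f 0 = 1 \<Longrightarrow> f * recip f = 1"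
  unfolding recip_def by (rule fps_right_inverse) simp

lemma fps_nth_mult_power_eq_0:
  fixes a b :: "'a::comm_ring_1 fps"
  assumes "fps_nth a 0 = 0" "fps_nth b 0 = 0" "j \<le> i"
  shows "fps_nth (a * b ^ i) j = 0"
  unfolding fps_mult_nth
proof (intro sum.neutral ballI)
  fix l assume "l \<in> {0..j}"
  show "fps_nth a l * fps_nth (b ^ i) (j - l) = 0"
  proof (cases "l = 0")
    case False
    then have "j - l < i" using \<open>l \<in> {0..j}\<close> assms(3) by auto
    then show ?thesis using startsby_zero_power_prefix[OF assms(2), of i] by simp
  qed (simp add: assms(1))
qed

lemma qpoch_inf_converges:
  fixes a b :: "'a::idom fps"
  assumes "fps_nth a 0 = 0" "fps_nth b 0 = 0"
  shows qpoch_inf_has_prod: "(\<lambda>k. 1 - a * b ^ k) has_prod qpoch_inf a b"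
    and fps_nth_qpoch_inf_0: "fps_nth (qpoch_inf a b) 0 = 1"
proof -
  define P where "P n = (\<Prod>i\<le>n. 1 - a * b ^ i)" for n
  define L where "L = Abs_fps (\<lambda>j. fps_nth (P j) j)"
  have nth_P_Suc: "fps_nth (P (Suc n)) j = fps_nth (P n) j" if "j \<le> n" for n j
  proof -
    have "P (Suc n) = P n - P n * (a * b ^ Suc n)"
      by (simp add: P_def algebra_simps)
    moreover have "fps_nth (P n * (a * b ^ Suc n)) j = 0"
      unfolding fps_mult_nth[of "P n"]
    proof (intro sum.neutral ballI)
      fix l
      show "fps_nth (P n) l * fps_nth (a * b ^ Suc n) (j - l) = 0"
        using fps_nth_mult_power_eq_0[OF assms, of "j - l" "Suc n"] that by simp
    qed
    ultimately show ?thesis by simp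
  qed
  have stable: "fps_nth (P n) j = fps_nth (P j) j" if "j \<le> n" for n j
    using that
  proof (induction n rule: dec_induct)
    case (step n)
    then show ?case using nth_P_Suc[of j n] by simp
  qed simp
  have "P \<longlonglongrightarrow> L"
  proof (rule tendsto_fpsI)
    fix j
    show "\<forall>\<^sub>F n in sequentially. fps_nth (P n) j = fps_nth L j"
      using eventually_ge_at_top[of j]
      by eventually_elim (unfold L_def fps_nth_Abs_fps, rule stable)
  qed
  moreover have L0: "fps_nth L 0 = 1"
    by (simp add: L_def P_def assms)
  then have "L \<noteq> 0" by auto
  ultimately have "(\<lambda>k. 1 - a * b ^ k) has_prod L"
    unfolding has_prod_def raw_has_prod_def P_def by simp
  moreover from this have "qpoch_inf a b = L"
    unfolding qpoch_inf_def by (rule has_prod_unique[symmetric])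
  ultimately show "(\<lambda>k. 1 - a * b ^ k) has_prod qpoch_inf a b"
    and "fps_nth (qpoch_inf a b) 0 = 1"
    using L0 by simp_all
qed

lemma fps_nth_qpoch_0: "fps_nth a 0 = 0 \<Longrightarrow> fps_nth (qpoch a b n) 0 = 1"
  for a b :: "'a::comm_ring_1 fps"
  unfolding qpoch_def by (induction n) simp_all

lemma C1_term_eq:
  assumes "n \<ge> 1"
  shows "C1_term n * (qpoch_inf (z_pow 1 * qX ^ n) qX * qpoch_inf (z_pow (-1) * qX ^ n) qX)
           * (qpoch qX (qX ^ 2) n * qpoch qX qX n) = qX ^ n"
proof -
  let ?f = "qpoch_inf (z_pow 1 * qX ^ n) qX * qpoch_inf (z_pow (-1) * qX ^ n) qX"
  let ?g = "qpoch qX (qX ^ 2) n * qpoch qX qX n"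
  have "?f * recip ?f = 1" "?g * recip ?g = 1"
    using assms by (simp_all add: mult_recip fps_nth_qpoch_inf_0 fps_nth_qpoch_0)
  moreover have "C1_term n * ?f * ?g = qX ^ n * (?f * recip ?f) * (?g * recip ?g)"
    unfolding C1_term_def by (simp only: mult_ac)
  ultimately show ?thesis by simp
qed

lemma summable_C1_term: "summable (\<lambda>n. C1_term (Suc n))"
proof -
  have zero: "fps_nth (C1_term n) j = 0" if "j < n" for n j
    using that unfolding C1_term_def by (simp add: mult.assoc fps_X_power_mult_nth)
  define S where "S n = (\<Sum>i<n. C1_term (Suc i))" for n
  define L where "L = Abs_fps (\<lambda>j. fps_nth (S j) j)"
  have stable: "fps_nth (S n) j = fps_nth (S j) j" if "j \<le> n" for n j
    using that by (induction n rule: dec_induct) (simp_all add: S_def zero)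
  have "S \<longlonglongrightarrow> L"
  proof (rule tendsto_fpsI)
    fix j
    show "\<forall>\<^sub>F n in sequentially. fps_nth (S n) j = fps_nth L j"
      using eventually_ge_at_top[of j]
      by eventually_elim (unfold L_def fps_nth_Abs_fps, rule stable)
  qed
  then show ?thesis
    unfolding summable_def sums_def S_def by blast
qed

end

theory Submission
  imports Defs
begin

text \<open>
  Write \<open>D\<^sub>m\<close> for the generating function of \<open>N_C1 m n - N_C1 (m + 1) n\<close>. The proof evaluates it exactly as
  \<open>D\<^sub>m = 1/(q\<^sup>2;q\<^sup>2)\<^sub>\<infinity> \<cdot> (\<Sum>\<^bsub>r\<ge>1\<^esub> (-1)\<^bsup>r-1\<^esup> q\<^bsup>r(r+1)/2 + rm\<^esup> + \<Sum>\<^bsub>s\<ge>1\<^esub> (-1)\<^sup>s q\<^bsup>3s^2 + s + 2sm\<^esup>)\<close>,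
  the first sum being of crank type and the second of rank type, and then reads off the sign.

  The evaluation rests on two Bailey pairs relative to 1. The sequence \<open>1/((q;q\<^sup>2)\<^sub>n (q)\<^sub>n)\<close> in the
  definition is the \<open>\<beta>\<close>-part of Slater's pair C(1), and the unit pair has \<open>\<beta>\<^sub>n = 0\<close> for \<open>n \<ge> 1\<close>. Subtracting
  the two cancels the term with \<open>r = 0\<close>, so for \<open>n \<ge> 1\<close> the sequence is a combination of
  \<open>1/((q)\<^bsub>n-r\<^esub> (q)\<^bsub>n+r\<^esub>)\<close> with \<open>r \<ge> 1\<close> only (\<open>slater_beta_expansion\<close>). For each such \<open>r\<close> the sum
  over \<open>n\<close> telescopes (\<open>recip_tails_telescope\<close>) and leaves \<open>q\<^sup>r / ((1 - z q\<^sup>r)(1 - q\<^sup>r/z))\<close>. Dropping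
  the term with \<open>r = 0\<close> is what avoids the factor \<open>(1-z)(1-1/z)\<close>, which is not invertible. In the
  remaining fraction the difference of the coefficients of \<open>z\<^sup>m\<close> and \<open>z\<^bsup>m+1\<^esup>\<close> is
  \<open>q\<^bsup>r(m+1)\<^esup>/(1 + q\<^sup>r)\<close> (\<open>zcoeff_two_sided_geom\<close>), and \<open>1 + q\<^sup>r\<close> divides the coefficient coming from the
  two pairs. This gives \<open>N_C1_diff_eq_crank_rank_sum\<close>.

  For the sign, \<open>1/(q\<^sup>2;q\<^sup>2)\<^sub>\<infinity>\<close> is even in \<open>q\<close>, so only exponents of the parity of \<open>n\<close> contribute. The rank
  exponents are all even. If \<open>n\<close> is odd, the crank exponents that remain come in adjacent pairs of
  opposite sign, and monotonicity of the partition numbers \<open>p\<close> decides. If \<open>n = 2M\<close>, then the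
  crank sum is asymptotically \<open>p(M)/4\<close> for even \<open>m\<close> and \<open>3p(M)/4\<close> for odd \<open>m\<close>, while the rank sum is
  asymptotically \<open>-p(M)/2\<close>. Crude forms of these estimates suffice: each sum collects every other increment of
  \<open>p(M - x)\<close> along an increasing sequence of breakpoints, and since \<open>p\<close> is convex the ratio of the gap
  lengths bounds the share of the total \<open>p(M)\<close> that is collected (\<open>alternating_gaps\<close>). Terms
  discarded at the beginning shift the argument by a bounded amount, which is harmless because \<open>p(n - c) / p(n)\<close> tends to 1 (\<open>partitions_shift\<close>).
\<close>

section \<open>Partition numbers\<close>

text \<open>
  The number of partitions of \<open>n\<close> into parts of size at most \<open>k\<close>; the second equation
  splits according to whether a part of size \<open>k + 1\<close> occurs.
\<close>

fun bounded_partitions :: "nat \<Rightarrow> nat \<Rightarrow> int" where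
  "bounded_partitions 0 n = (if n = 0 then 1 else 0)"
| "bounded_partitions (Suc k) n = bounded_partitions k n + (if Suc k \<le> n then bounded_partitions (Suc k) (n - Suc k) else 0)"

declare bounded_partitions.simps(2) [simp del]
lemmas bounded_partitions_Suc = bounded_partitions.simps(2)

definition partitions :: "nat \<Rightarrow> int" where
  "partitions n = bounded_partitions n n"

lemma bounded_partitions_0 [simp]: "bounded_partitions k 0 = 1"
  by (induction k) (auto simp: bounded_partitions_Suc)

lemma bounded_partitions_1 [simp]: "bounded_partitions (Suc 0) n = 1"
  by (induction n rule: less_induct) (subst bounded_partitions_Suc, auto)

lemma bounded_partitions_eq_partitions: "n \<le> k \<Longrightarrow> bounded_partitions k n = partitions n"
  by (induction k rule: dec_induct) (auto simp: partitions_def bounded_partitions_Suc)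

text \<open>
  Equals the number of partitions of \<open>n\<close> into parts between 2 and \<open>k\<close> when \<open>k \<ge> 1\<close>.
  It is written as a difference because the convexity of the partition numbers is a statement
  about these differences.
\<close>
definition bounded_partitions_diff :: "nat \<Rightarrow> nat \<Rightarrow> int" where
  "bounded_partitions_diff k n = bounded_partitions k n - (if n = 0 then 0 else bounded_partitions k (n - 1))"

lemma bounded_partitions_diff_Suc:
  assumes "k \<ge> 1"
  shows "bounded_partitions_diff (Suc k) n = bounded_partitions_diff k n + (if Suc k \<le> n then bounded_partitions_diff (Suc k) (n - Suc k) else 0)"
proof -
  consider "n = 0" | "0 < n" "n < Suc k" | "n = Suc k" | "n > Suc k" by linarith
  then show ?thesis
  proof cases
    case 4
    then have "n - Suc 0 - Suc k = n - Suc k - Suc 0" by simp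
    with 4 show ?thesis by (simp add: bounded_partitions_diff_def bounded_partitions_Suc[of k n] bounded_partitions_Suc[of k "n - Suc 0"])
  qed (use assms in \<open>auto simp: bounded_partitions_diff_def bounded_partitions_Suc[of k n] bounded_partitions_Suc[of k "n - Suc 0"] bounded_partitions_Suc[of k "Suc k"] bounded_partitions_Suc[of k k]\<close>)
qed

lemma bounded_partitions_diff_nonneg: "k \<ge> 1 \<Longrightarrow> bounded_partitions_diff k n \<ge> 0"
proof (induction k n rule: bounded_partitions.induct)
  case (2 k n)
  show ?case
  proof (cases "k = 0")
    case True
    then show ?thesis by (simp add: bounded_partitions_diff_def)
  next
    case False
    with 2 show ?thesis by (subst bounded_partitions_diff_Suc) auto
  qed
qed auto

lemma bounded_partitions_diff_mono: "k \<ge> 1 \<Longrightarrow> bounded_partitions_diff k n \<le> bounded_partitions_diff (Suc k) n"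
  using bounded_partitions_diff_Suc[of k n] bounded_partitions_diff_nonneg[of "Suc k" "n - Suc k"] by auto

text \<open>
  The summand for \<open>l\<close> counts the partitions without parts 1 whose largest part is \<open>l\<close>.
\<close>
lemma bounded_partitions_diff_largest_part:
  assumes "k \<ge> 1" "n \<ge> 1"
  shows "bounded_partitions_diff k n = (\<Sum>l=2..k. if l \<le> n then bounded_partitions_diff l (n - l) else 0)"
  using assms(1)
proof (induction k rule: dec_induct)
  case base
  then show ?case using assms by (simp add: bounded_partitions_diff_def)
next
  case (step k)
  then have "{2..Suc k} = insert (Suc k) {2..k}" by auto
  then show ?case using step by (simp add: bounded_partitions_diff_Suc[of k n])
qed

lemma bounded_partitions_diff_eq_partitions: "n \<ge> 1 \<Longrightarrow> k \<ge> n \<Longrightarrow> bounded_partitions_diff k n = partitions n - partitions (n - 1)"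
  by (simp add: bounded_partitions_diff_def bounded_partitions_eq_partitions)

text \<open>
  The difference \<open>p(n) - p(n - 1)\<close> counts the partitions of \<open>n\<close> without parts 1. Adding 1 to the
  largest part maps these injectively to such partitions of \<open>n + 1\<close>; in terms of counts, the summand
  for largest part \<open>l\<close> moves to \<open>l + 1\<close>. The empty partition has no largest part, hence the
  assumption.
\<close>
lemma partitions_convex:
  assumes "n \<ge> 1"
  shows "partitions n - partitions (n - 1) \<le> partitions (Suc n) - partitions n"
proof -
  have "partitions n - partitions (n - 1) = (\<Sum>l=2..n. bounded_partitions_diff l (n - l))"
    using assms bounded_partitions_diff_largest_part[of n n] bounded_partitions_diff_eq_partitions[of n n] by simp
  also have "\<dots> \<le> (\<Sum>l=2..n. bounded_partitions_diff (Suc l) (n - l))"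
    by (intro sum_mono bounded_partitions_diff_mono) auto
  also have "\<dots> = (\<Sum>l=3..Suc n. bounded_partitions_diff l (Suc n - l))"
    by (rule sum.reindex_bij_witness[of _ "\<lambda>l. l - 1" Suc]) (auto simp: Suc_diff_le)
  also have "\<dots> \<le> (\<Sum>l=2..Suc n. bounded_partitions_diff l (Suc n - l))"
    by (rule sum_mono2) (auto intro: bounded_partitions_diff_nonneg)
  also have "\<dots> = partitions (Suc n) - partitions n"
    using assms bounded_partitions_diff_largest_part[of "Suc n" "Suc n"] bounded_partitions_diff_eq_partitions[of "Suc n" "Suc n"] by simp
  finally show ?thesis .
qed

lemma partitions_0 [simp]: "partitions 0 = 1" by (simp add: partitions_def)
lemma partitions_1 [simp]: "partitions (Suc 0) = 1" by (simp add: partitions_def)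

lemma partitions_strict: "n \<ge> 1 \<Longrightarrow> partitions (Suc n) \<ge> partitions n + 1"
proof (induction n rule: dec_induct)
  case base
  then show ?case by (simp add: partitions_def numeral_2_eq_2 bounded_partitions_Suc[of "Suc 0"])
next
  case (step n)
  then show ?case using partitions_convex[of "Suc n"] by simp
qed

lemma partitions_mono: "mono partitions"
proof (rule incseq_SucI)
  fix n show "partitions n \<le> partitions (Suc n)"
    using partitions_strict[of n] by (cases "n = 0") auto
qed

lemma partitions_ge: "partitions n \<ge> int n"
proof (cases "n = 0")
  case False
  then have "n \<ge> 1" by simp
  then show ?thesis
    by (induction n rule: dec_induct) (use partitions_strict in \<open>force+\<close>)
qed simp

lemma partitions_nonneg: "partitions n \<ge> 0"
  using partitions_ge[of n] by simp

section \<open>Partitions without ones are rare\<close>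

definition divisor_sum :: "nat \<Rightarrow> nat" where "divisor_sum n = \<Sum>{d. d dvd n}"

lemma bounded_partitions_gf: "Abs_fps (bounded_partitions (Suc k)) * (1 - fps_X ^ Suc k) = Abs_fps (bounded_partitions k)"
proof (rule fps_ext)
  fix n
  show "fps_nth (Abs_fps (bounded_partitions (Suc k)) * (1 - fps_X ^ Suc k)) n = fps_nth (Abs_fps (bounded_partitions k)) n"
    unfolding right_diff_distrib fps_sub_nth mult_1_right fps_X_power_mult_right_nth fps_nth_Abs_fps
    using bounded_partitions_Suc[of k n] by (auto split: if_splits)
qed

text \<open>
  The generating function is a product of factors \<open>1/(1 - x\<^sup>d)\<close>, and \<open>x\<close> times the logarithmic derivative of one
  such factor is \<open>d x\<^sup>d/(1 - x\<^sup>d)\<close>, which contributes \<open>d\<close> at every positive multiple of \<open>d\<close>.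
\<close>
lemma bounded_partitions_log_deriv:
  "fps_X * fps_deriv (Abs_fps (bounded_partitions k)) =
     Abs_fps (bounded_partitions k) * Abs_fps (\<lambda>n. if n = 0 then 0 else int (\<Sum>d | d \<in> {1..k} \<and> d dvd n. d))"
proof (induction k)
  case 0
  have "Abs_fps (\<lambda>n. if n = 0 then 1 else 0 :: int) = 1" by (rule fps_ext) simp
  moreover have "Abs_fps (\<lambda>n. if n = 0 then 0 else int (\<Sum>d | d \<in> {1..0} \<and> d dvd n. d)) = 0"
    by (rule fps_ext) simp
  ultimately show ?case by simp
next
  case (Suc k)
  define G where "G k = Abs_fps (bounded_partitions k)" for k
  define L where "L k = Abs_fps (\<lambda>n. if n = 0 then 0 else int (\<Sum>d | d \<in> {1..k} \<and> d dvd n. d))" for k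
  define T where "T = Abs_fps (\<lambda>n. if n > 0 \<and> Suc k dvd n then int (Suc k) else 0)"
  define Y where "Y = (fps_X :: int fps) ^ Suc k"
  have T: "T * (1 - Y) = of_nat (Suc k) * Y"
  proof (rule fps_ext)
    fix n
    consider "n < Suc k" "n > 0" | "n = 0" | "n = Suc k" | "n > Suc k" by linarith
    then show "fps_nth (T * (1 - Y)) n = fps_nth (of_nat (Suc k) * Y) n"
      unfolding T_def Y_def right_diff_distrib fps_sub_nth mult_1_right fps_X_power_mult_right_nth
        fps_mult_of_nat_nth fps_X_power_nth fps_nth_Abs_fps
      by cases (simp_all add: dvd_minus_self nat_dvd_not_less del: of_nat_Suc)
  qed
  have L: "L (Suc k) = L k + T"
  proof (rule fps_ext)
    fix n
    have "{d \<in> {1..Suc k}. d dvd n} = (if Suc k dvd n then insert (Suc k) {d \<in> {1..k}. d dvd n}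
            else {d \<in> {1..k}. d dvd n})" by (auto simp: le_Suc_eq)
    then show "fps_nth (L (Suc k)) n = fps_nth (L k + T) n"
      by (simp add: L_def T_def)
  qed
  have G: "G (Suc k) * (1 - Y) = G k" using bounded_partitions_gf unfolding G_def Y_def .
  have dY: "fps_X * fps_deriv Y = of_nat (Suc k) * Y"
    unfolding Y_def
    by (rule fps_ext) (auto simp: fps_mult_of_nat_nth fps_X_power_nth simp del: power_Suc of_nat_Suc)
  have dG: "fps_X * fps_deriv (G k) = fps_X * fps_deriv (G (Suc k)) * (1 - Y) - G (Suc k) * (of_nat (Suc k) * Y)"
    unfolding G[symmetric] dY[symmetric] by (simp add: algebra_simps)
  have IH: "fps_X * fps_deriv (G k) = G k * L k" using Suc unfolding G_def L_def .
  have "(fps_X * fps_deriv (G (Suc k))) * (1 - Y) = fps_X * fps_deriv (G k) + G (Suc k) * (of_nat (Suc k) * Y)"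
    using dG by simp
  also have "\<dots> = G (Suc k) * (1 - Y) * L k + G (Suc k) * (T * (1 - Y))"
    by (simp only: IH G T)
  also have "\<dots> = (G (Suc k) * L (Suc k)) * (1 - Y)"
    by (simp add: L algebra_simps)
  finally have "(fps_X * fps_deriv (G (Suc k))) * (1 - Y) = (G (Suc k) * L (Suc k)) * (1 - Y)" .
  moreover have "fps_nth (1 - Y) 0 \<noteq> 0" unfolding Y_def by simp
  then have "1 - Y \<noteq> 0" by force
  ultimately have "fps_X * fps_deriv (G (Suc k)) = G (Suc k) * L (Suc k)" by simp
  then show ?case unfolding G_def L_def .
qed

lemma partitions_divisor_sum_recurrence: "int n * partitions n = (\<Sum>i=1..n. int (divisor_sum i) * partitions (n - i))"
proof (cases "n = 0")
  case False
  have "int n * partitions n = fps_nth (fps_X * fps_deriv (Abs_fps (bounded_partitions n))) n"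
    using False by (simp add: partitions_def)
  also have "\<dots> = (\<Sum>i=0..n. (if i = 0 then 0 else int (\<Sum>d | d \<in> {1..n} \<and> d dvd i. d)) * bounded_partitions n (n - i))"
    unfolding bounded_partitions_log_deriv by (subst mult.commute) (simp add: fps_mult_nth)
  also have "\<dots> = (\<Sum>i=1..n. int (divisor_sum i) * partitions (n - i))"
  proof (rule sum.mono_neutral_cong_right)
    fix i assume "i \<in> {1..n}"
    then have "{d \<in> {1..n}. d dvd i} = {d. d dvd i}"
      by (auto dest: dvd_imp_le intro: Suc_leI dvd_pos_nat)
    with \<open>i \<in> _\<close> show "(if i = 0 then 0 else int (\<Sum>d | d \<in> {1..n} \<and> d dvd i. d)) * bounded_partitions n (n - i)
      = int (divisor_sum i) * partitions (n - i)"
      by (simp add: divisor_sum_def bounded_partitions_eq_partitions)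
  qed auto
  finally show ?thesis .
qed simp

text \<open>
  Divisors \<open>d \<le> i/k\<close> number at most \<open>i\<close>, and the others are of the form \<open>i/e\<close> with \<open>e < k\<close>. Choosing \<open>k\<close>
  large shows that the divisor sum is \<open>o(i\<^sup>2)\<close>.
\<close>
lemma divisor_sum_bounds:
  assumes "i \<ge> 1"
  shows "i \<le> divisor_sum i" and "k \<ge> 1 \<Longrightarrow> real (divisor_sum i) \<le> real i ^ 2 / real k + real k * real i"
proof -
  have fin: "finite {d. d dvd i}" using assms by simp
  show "i \<le> divisor_sum i" unfolding divisor_sum_def
    by (rule member_le_sum) (use fin in auto)
  assume k: "k \<ge> 1"
  let ?S = "{d. d dvd i \<and> d * k \<le> i}" and ?B = "{d. d dvd i \<and> \<not> d * k \<le> i}"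
  have "{d. d dvd i} = ?S \<union> ?B" by auto
  then have "divisor_sum i = \<Sum>(?S \<union> ?B)" unfolding divisor_sum_def by presburger
  also have "\<dots> = \<Sum>?S + \<Sum>?B"
    by (rule sum.union_disjoint) (use fin in \<open>auto intro: finite_subset\<close>)
  finally have eq: "real (divisor_sum i) = (\<Sum>d\<in>?S. real d) + (\<Sum>d\<in>?B. real d)" by simp
  have "(\<Sum>d\<in>?S. real d) \<le> real (card ?S) * (real i / real k)"
  proof (rule sum_bounded_above)
    fix d assume "d \<in> ?S"
    then have "real (d * k) \<le> real i" by (simp only: of_nat_le_iff) auto
    then show "real d \<le> real i / real k" using k by (simp add: field_simps)
  qed
  also have "card ?S \<le> card {1..i}"
    by (rule card_mono) (use assms in \<open>auto dest: dvd_imp_le intro: Suc_leI dvd_pos_nat\<close>)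
  then have "real (card ?S) * (real i / real k) \<le> real i * (real i / real k)"
    by (intro mult_right_mono) auto
  finally have S: "(\<Sum>d\<in>?S. real d) \<le> real i ^ 2 / real k" by (simp add: power2_eq_square)
  have "?B \<subseteq> (\<lambda>e. i div e) ` {1..k}"
  proof
    fix d assume "d \<in> ?B"
    then obtain e where e: "i = d * e" "i < d * k" by (auto elim: dvdE)
    then have "e < k" "e \<ge> 1" "d \<ge> 1" using assms by (auto simp: Suc_le_eq intro: Nat.gr0I)
    then show "d \<in> (\<lambda>e. i div e) ` {1..k}" using e by (intro image_eqI[of _ _ e]) auto
  qed
  then have "card ?B \<le> k" using surj_card_le[of "{1..k}" ?B] by simp
  have "(\<Sum>d\<in>?B. real d) \<le> real (card ?B) * real i"
    by (rule sum_bounded_above) (use assms in \<open>auto dest: dvd_imp_le\<close>)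
  also have "\<dots> \<le> real k * real i" using \<open>card ?B \<le> k\<close> by (intro mult_right_mono) auto
  finally show "real (divisor_sum i) \<le> real i ^ 2 / real k + real k * real i" using S eq by simp
qed

definition partitions_without_1 :: "nat \<Rightarrow> int" where
  "partitions_without_1 n = (if n = 0 then 1 else partitions n - partitions (n - 1))"

lemma partitions_without_1_nonneg: "partitions_without_1 n \<ge> 0"
  using partitions_mono[THEN monoD, of "n-1" n] by (simp add: partitions_without_1_def)

lemma sum_partitions_without_1: "(\<Sum>j\<le>n. partitions_without_1 (n - j)) = partitions n"
proof -
  have "(\<Sum>j\<le>n. partitions_without_1 j) = partitions n"
    by (induction n) (auto simp: partitions_without_1_def)
  then show ?thesis using sum.nat_diff_reindex[of partitions_without_1 "Suc n"]
    by (simp add: lessThan_Suc_atMost)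
qed

text \<open>
  Both bounds below compare a divisor-type convolution with the same sequence. This one subtracts the
  recurrences for \<open>n\<close> and \<open>n - 1\<close>.
\<close>
lemma partitions_without_1_upper: "int n * partitions_without_1 n \<le> (\<Sum>i=1..n. int (divisor_sum i) * partitions_without_1 (n - i))"
proof (cases n)
  case (Suc k)
  have "(\<Sum>i=1..n. int (divisor_sum i) * partitions_without_1 (n - i)) =
        (\<Sum>i=1..k. int (divisor_sum i) * partitions_without_1 (n - i)) + int (divisor_sum n)"
    by (simp add: Suc partitions_without_1_def)
  also have "(\<Sum>i=1..k. int (divisor_sum i) * partitions_without_1 (n - i)) =
        (\<Sum>i=1..k. int (divisor_sum i) * partitions (n - i)) - (\<Sum>i=1..k. int (divisor_sum i) * partitions (k - i))"
    unfolding sum_subtractf[symmetric]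
    by (rule sum.cong) (auto simp: Suc partitions_without_1_def Suc_diff_le algebra_simps)
  also have "\<dots> + int (divisor_sum n) = int n * partitions n - int k * partitions k"
    unfolding partitions_divisor_sum_recurrence[of n] partitions_divisor_sum_recurrence[of k] by (simp add: Suc)
  also have "\<dots> = int n * partitions_without_1 n + partitions k"
    by (simp add: Suc partitions_without_1_def algebra_simps)
  finally show ?thesis using partitions_ge[of k] by simp
qed simp

text \<open>
  Since a divisor sum is at least its argument, the recurrence bounds \<open>n p(n)\<close> below by the convolution of \<open>p\<close> with
  the identity, and expressing \<open>p\<close> by its differences sums the identity to triangular numbers.
\<close>
lemma partitions_lower: "(\<Sum>j\<le>n. int (j * Suc j) * partitions_without_1 (n - j)) \<le> 2 * (int n * partitions n)"
proof -
  have E: "(\<Sum>j\<le>n. int (Suc j) * partitions_without_1 (n - j)) = (\<Sum>j\<le>n. partitions (n - j))" for n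
  proof (induction n)
    case 0 then show ?case by (simp add: partitions_without_1_def)
  next
    case (Suc n)
    have "(\<Sum>j\<le>Suc n. int (Suc j) * partitions_without_1 (Suc n - j)) =
       (\<Sum>j\<le>Suc n. int j * partitions_without_1 (Suc n - j)) + (\<Sum>j\<le>Suc n. partitions_without_1 (Suc n - j))"
      unfolding sum.distrib[symmetric] by (simp add: algebra_simps)
    also have "(\<Sum>j\<le>Suc n. int j * partitions_without_1 (Suc n - j)) = (\<Sum>j\<le>n. partitions (n - j))"
      unfolding Suc[symmetric] by (subst sum.atMost_Suc_shift) simp
    finally show ?case unfolding sum_partitions_without_1
      by (subst sum.atMost_Suc_shift) simp
  qed
  have "(\<Sum>j\<le>n. int (j * Suc j) * partitions_without_1 (n - j)) = 2 * (\<Sum>j\<le>n. int j * partitions (n - j))"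
  proof (induction n)
    case (Suc n)
    have "(\<Sum>j\<le>Suc n. int (j * Suc j) * partitions_without_1 (Suc n - j)) =
       (\<Sum>j\<le>n. int (j * Suc j) * partitions_without_1 (n - j)) + 2 * (\<Sum>j\<le>n. int (Suc j) * partitions_without_1 (n - j))"
      unfolding sum_distrib_left sum.distrib[symmetric]
      by (subst sum.atMost_Suc_shift) (simp add: algebra_simps)
    also have "\<dots> = 2 * (\<Sum>j\<le>n. int (Suc j) * partitions (n - j))"
      unfolding Suc E unfolding sum_distrib_left sum.distrib[symmetric]
      by (simp add: algebra_simps)
    also have "\<dots> = 2 * (\<Sum>j\<le>Suc n. int j * partitions (Suc n - j))"
      by (subst sum.atMost_Suc_shift) simp
    finally show ?case .
  qed simp
  also have "(\<Sum>j\<le>n. int j * partitions (n - j)) = (\<Sum>j=1..n. int j * partitions (n - j))"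
    by (rule sum.mono_neutral_right) auto
  also have "\<dots> \<le> (\<Sum>j=1..n. int (divisor_sum j) * partitions (n - j))"
    by (intro sum_mono mult_right_mono) (use divisor_sum_bounds(1) partitions_nonneg in auto)
  also have "\<dots> = int n * partitions n" by (rule partitions_divisor_sum_recurrence[symmetric])
  finally show ?thesis by simp
qed

text \<open>
  The weights in \<open>partitions_without_1_upper\<close> are \<open>o(i\<^sup>2)\<close> while those in \<open>partitions_lower\<close> are
  \<open>i (i + 1)\<close>, so \<open>n (p(n) - p(n - 1)) \<le> (C + \<epsilon> n) p(n)\<close> with a constant \<open>C\<close> that depends on \<open>\<epsilon>\<close> only.
\<close>
lemma partitions_without_1_small:
  assumes "\<epsilon> > 0"
  shows "eventually (\<lambda>n. real_of_int (partitions_without_1 n) \<le> \<epsilon> * real_of_int (partitions n)) sequentially"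
proof -
  obtain k :: nat where k: "k \<ge> 1" "real k > 8 / \<epsilon>"
    using reals_Archimedean2[of "max 1 (8/\<epsilon>)"]
    by (metis less_imp_le max_less_iff_conj of_nat_1 of_nat_le_iff)
  \<comment> \<open>Beyond \<open>J\<close> the linear term of \<open>divisor_sum_bounds\<close> is dominated by the quadratic one.\<close>
  define J where "J = k ^ 2"
  define C where "C = real (\<Sum>i\<le>J. divisor_sum i)"
  have "C \<ge> 0" unfolding C_def by (rule of_nat_0_le_iff)
  have k4: "4 / real k \<le> \<epsilon> / 2" using k assms by (simp add: field_simps)
  have dJ: "real (divisor_sum i) \<le> C + \<epsilon> / 4 * real (i * Suc i)" if "i \<ge> 1" for i
  proof (cases "i \<le> J")
    case True
    then have "divisor_sum i \<le> (\<Sum>i\<le>J. divisor_sum i)" by (intro member_le_sum) auto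
    then have "real (divisor_sum i) \<le> C" unfolding C_def by (simp only: of_nat_le_iff)
    then show ?thesis using assms by (simp add: add_increasing2)
  next
    case False
    then have "real k ^ 2 \<le> real i" unfolding J_def by (simp flip: of_nat_power)
    then have "real k * real i \<le> real i ^ 2 / real k"
      using k(1) that by (simp add: field_simps power2_eq_square)
    then have "real (divisor_sum i) \<le> 2 * (real i ^ 2 / real k)"
      using divisor_sum_bounds(2)[OF that k(1)] by simp
    also have "\<dots> = (2 / real k) * real i ^ 2" by simp
    also have "\<dots> \<le> (\<epsilon> / 4) * real (i * Suc i)"
      using k4 assms by (intro mult_mono) (auto simp: power2_eq_square field_simps)
    finally show ?thesis using \<open>C \<ge> 0\<close> by linarith
  qed
  have main: "real n * partitions_without_1 n \<le> (C + \<epsilon> / 2 * n) * partitions n" for n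
  proof -
    have dn: "real_of_int (partitions_without_1 i) \<ge> 0" for i using partitions_without_1_nonneg by simp
    have "real n * partitions_without_1 n \<le> real_of_int (\<Sum>i=1..n. int (divisor_sum i) * partitions_without_1 (n - i))"
    proof -
      have "real n * partitions_without_1 n = real_of_int (int n * partitions_without_1 n)" by simp
      also have "\<dots> \<le> real_of_int (\<Sum>i=1..n. int (divisor_sum i) * partitions_without_1 (n - i))"
        by (rule of_int_le_iff[THEN iffD2], rule partitions_without_1_upper)
      finally show ?thesis .
    qed
    also have "\<dots> = (\<Sum>i=1..n. real (divisor_sum i) * partitions_without_1 (n - i))" by simp
    also have "\<dots> \<le> (\<Sum>i=1..n. (C + \<epsilon> / 4 * real (i * Suc i)) * partitions_without_1 (n - i))"
      by (intro sum_mono mult_right_mono dJ dn) auto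
    also have "\<dots> \<le> (\<Sum>i\<le>n. (C + \<epsilon> / 4 * real (i * Suc i)) * partitions_without_1 (n - i))"
      by (rule sum_mono2) (use dn assms in \<open>auto simp: C_def intro!: mult_nonneg_nonneg add_nonneg_nonneg sum_nonneg\<close>)
    also have "\<dots> = C * real_of_int (\<Sum>i\<le>n. partitions_without_1 (n - i))
        + \<epsilon> / 4 * real_of_int (\<Sum>i\<le>n. int (i * Suc i) * partitions_without_1 (n - i))"
      unfolding of_int_sum sum_distrib_left sum.distrib[symmetric]
      by (rule sum.cong) (auto simp: algebra_simps)
    also have "\<dots> \<le> C * partitions n + \<epsilon> / 4 * real_of_int (2 * (int n * partitions n))"
      unfolding sum_partitions_without_1
    proof (intro add_left_mono mult_left_mono)
      show "real_of_int (\<Sum>i\<le>n. int (i * Suc i) * partitions_without_1 (n - i)) \<le> real_of_int (2 * (int n * partitions n))"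
        unfolding of_int_le_iff by (rule partitions_lower)
    qed (use assms in simp)
    also have "\<dots> = (C + \<epsilon> / 2 * n) * partitions n" by (simp add: algebra_simps)
    finally show ?thesis .
  qed
  obtain n1 :: nat where n1: "real n1 > 2 * C / \<epsilon>" using reals_Archimedean2 by blast
  show ?thesis
  proof (rule eventually_sequentiallyI[of "max 1 n1"])
    fix n assume n: "n \<ge> max 1 n1"
    then have "real n1 \<le> real n" by simp
    then have "2 * C / \<epsilon> \<le> real n" using n1 by linarith
    then have "C + \<epsilon> / 2 * n \<le> \<epsilon> * n" using assms by (simp add: field_simps)
    then have "(C + \<epsilon> / 2 * n) * partitions n \<le> (\<epsilon> * n) * partitions n"
      by (rule mult_right_mono) (simp add: partitions_nonneg)
    then have "real n * partitions_without_1 n \<le> real n * (\<epsilon> * partitions n)"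
      using main[of n] by (simp add: mult_ac)
    moreover have "real n > 0" using n by simp
    ultimately show "real_of_int (partitions_without_1 n) \<le> \<epsilon> * partitions n"
      by (simp only: mult_le_cancel_left_pos)
  qed
qed

text \<open>
  Convexity makes the last of the \<open>c\<close> differences between \<open>p(n - c)\<close> and \<open>p(n)\<close> the largest, and even
  that one is \<open>o(p(n))\<close>.
\<close>
lemma partitions_shift:
  fixes \<epsilon> :: real
  assumes "\<epsilon> > 0"
  shows "eventually (\<lambda>n. (1 - \<epsilon>) * partitions n \<le> partitions (n - c)) sequentially"
proof -
  have "eventually (\<lambda>n. real_of_int (partitions_without_1 n) \<le> \<epsilon> / (real c + 1) * partitions n) sequentially"
    using assms by (intro partitions_without_1_small) auto
  then show ?thesis using eventually_gt_at_top[of c]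
  proof eventually_elim
    case (elim n)
    have "partitions (n - k) \<ge> partitions n - int k * partitions_without_1 n \<and> partitions_without_1 (n - k) \<le> partitions_without_1 n" if "k < n" for k
      using that
    proof (induction k)
      case (Suc k)
      from Suc.prems have e: "Suc (n - Suc k) = n - k" "n - Suc 0 - k = n - Suc k" by simp_all
      have "partitions_without_1 (n - Suc k) \<le> partitions_without_1 (n - k)"
        using partitions_convex[of "n - Suc k"] Suc.prems e by (simp add: partitions_without_1_def)
      moreover have "partitions (n - Suc k) = partitions (n - k) - partitions_without_1 (n - k)"
        using Suc.prems e by (simp add: partitions_without_1_def)
      ultimately show ?case using Suc.IH Suc.prems by (auto simp: algebra_simps)
    qed simp
    then have "partitions n - int c * partitions_without_1 n \<le> partitions (n - c)" using elim(2) by blast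
    then have "real_of_int (partitions n - int c * partitions_without_1 n) \<le> real_of_int (partitions (n - c))"
      by (rule of_int_le_iff[THEN iffD2])
    then have "real_of_int (partitions (n - c)) \<ge> partitions n - real c * partitions_without_1 n" by simp
    moreover have "real c * partitions_without_1 n \<le> real c * (\<epsilon> / (real c + 1) * partitions n)"
      using elim by (intro mult_left_mono) auto
    moreover have "real c * (\<epsilon> / (real c + 1) * partitions n) \<le> \<epsilon> * partitions n"
    proof -
      have "partitions n \<ge> 0" using partitions_ge[of n] by simp
      moreover have "real c * (\<epsilon> / (real c + 1)) \<le> \<epsilon>" using assms by (simp add: field_simps)
      ultimately show ?thesis unfolding mult.assoc[symmetric] by (intro mult_right_mono) auto
    qed
    ultimately show ?case by (simp add: algebra_simps)
  qed
qed

section \<open>Alternating increments of a convex function\<close>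

lemma convex_chord:
  fixes \<phi> :: "int \<Rightarrow> real"
  assumes conv: "\<And>k. \<phi> k - \<phi> (k - 1) \<le> \<phi> (k + 1) - \<phi> k" and le: "w \<le> y" "y \<le> x"
  shows "(\<phi> y - \<phi> w) * (x - y) \<le> (\<phi> x - \<phi> y) * (y - w)"
proof -
  define d where "d k = \<phi> k - \<phi> (k - 1)" for k
  have d: "d i \<le> d j" if "i \<le> j" for i j
    using that
  proof (induction j rule: int_ge_induct)
    case (step j) then show ?case using conv[of j] by (simp add: d_def)
  qed simp
  have up: "\<phi> x - \<phi> y \<ge> (x - y) * d y"
    using le(2)
  proof (induction x rule: int_ge_induct)
    case (step x) then show ?case using d[of y "x + 1"] by (simp add: d_def algebra_simps)
  qed simp
  have down: "\<phi> y - \<phi> w \<le> (y - w) * d y"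
    using le(1)
  proof (induction w rule: int_le_induct)
    case (step w) then show ?case using d[of w y] by (simp add: d_def algebra_simps)
  qed simp
  have "(\<phi> y - \<phi> w) * (x - y) \<le> ((y - w) * d y) * (x - y)"
    by (rule mult_right_mono[OF down]) (use le in auto)
  also have "\<dots> = ((x - y) * d y) * (y - w)" by simp
  also have "\<dots> \<le> (\<phi> x - \<phi> y) * (y - w)"
    by (rule mult_right_mono[OF up]) (use le in auto)
  finally show ?thesis .
qed

text \<open>
  The breakpoints \<open>a\<^sub>0 \<le> b\<^sub>0 \<le> a\<^sub>1 \<le> b\<^sub>1 \<le> \<dots>\<close> cut the line into gaps. By convexity the increment of
  \<open>\<phi>(M - x)\<close> per unit length over \<open>[a\<^sub>i, b\<^sub>i]\<close> is at least that over the next gap \<open>[b\<^sub>i, a\<^bsub>i+1\<^esub>]\<close>, so a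
  comparison of lengths gives a comparison of increments.
\<close>
lemma alternating_gaps:
  fixes \<phi> :: "int \<Rightarrow> real" and a b :: "nat \<Rightarrow> int" and \<kappa> :: real
  assumes conv: "\<And>k. \<phi> k - \<phi> (k - 1) \<le> \<phi> (k + 1) - \<phi> k" and mono: "mono \<phi>"
    and ab: "\<And>i. a i \<le> b i" "\<And>i. b i \<le> a (Suc i)"
    and gap: "\<And>i. \<kappa> * (a (Suc i) - b i) \<le> b i - a i"
  shows "\<kappa> * (\<Sum>i<K. \<phi> (M - b i) - \<phi> (M - a (Suc i))) \<le> (\<Sum>i<K. \<phi> (M - a i) - \<phi> (M - b i))"
  unfolding sum_distrib_left
proof (rule sum_mono)
  fix i
  define X Y where "X = \<phi> (M - a i) - \<phi> (M - b i)" and "Y = \<phi> (M - b i) - \<phi> (M - a (Suc i))"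
  define s t where "s = real_of_int (b i - a i)" and "t = real_of_int (a (Suc i) - b i)"
  have nonneg: "X \<ge> 0" "Y \<ge> 0" "t \<ge> 0"
    using ab[of i] by (auto simp: X_def Y_def t_def intro!: monoD[OF mono])
  show "\<kappa> * Y \<le> X" unfolding X_def [symmetric] Y_def [symmetric]
  proof (cases "t = 0")
    case True
    then have "Y = 0" by (simp add: Y_def t_def)
    then show ?thesis using nonneg by simp
  next
    case False
    have "Y * s \<le> X * t"
      using convex_chord[of \<phi> "M - a (Suc i)" "M - b i" "M - a i", OF conv] ab[of i]
      by (simp add: X_def Y_def s_def t_def)
    moreover have "(\<kappa> * t) * Y \<le> s * Y"
      using gap[of i] nonneg by (intro mult_right_mono) (simp_all add: s_def t_def)
    ultimately have "(\<kappa> * Y) * t \<le> X * t" by (simp add: mult_ac)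
    then show ?thesis using False nonneg by (simp add: mult_le_cancel_right)
  qed
qed

lemma alternating_sum:
  fixes f :: "int \<Rightarrow> real" and a b :: "nat \<Rightarrow> int"
  shows "(\<Sum>i<K. f (a i) - f (b i)) + (\<Sum>i<K. f (b i) - f (a (Suc i))) = f (a 0) - f (a K)"
  by (induction K) auto

text \<open>
  Two extensions of the partition numbers to negative arguments are needed: zero is what the power series
  coefficients require, while the constant 1 keeps the function convex across 0 and 1. They differ by an
  indicator, whose alternating increments add up to at most 1.
\<close>
definition partitions_of_int :: "int \<Rightarrow> int" where
  "partitions_of_int k = (if k < 0 then 0 else partitions (nat k))"

definition partitions_extended :: "int \<Rightarrow> real" where
  "partitions_extended k = partitions (nat k)"

definition nonneg_ind :: "int \<Rightarrow> real" where
  "nonneg_ind k = (if k < 0 then 0 else 1)"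

lemma partitions_of_int_conv: "real_of_int (partitions_of_int k) = partitions_extended k - 1 + nonneg_ind k"
  by (simp add: partitions_of_int_def partitions_extended_def nonneg_ind_def)

lemma mono_partitions_extended: "mono partitions_extended"
  unfolding partitions_extended_def by (intro monoI) (auto intro!: monoD[OF partitions_mono] nat_mono)

lemma partitions_extended_convex: "partitions_extended k - partitions_extended (k - 1) \<le> partitions_extended (k + 1) - partitions_extended k"
proof (cases "k \<ge> 1")
  case True
  then have "nat (k - 1) = nat k - 1" "nat (k + 1) = Suc (nat k)" "nat k \<ge> 1" by auto
  then show ?thesis using partitions_convex[of "nat k"] unfolding partitions_extended_def
    by (metis of_int_diff of_int_le_iff)
next
  case False
  then show ?thesis using mono_partitions_extended[THEN monoD, of k "k + 1"] by (simp add: partitions_extended_def)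
qed

lemma partitions_extended_ge_1: "partitions_extended k \<ge> 1"
  using partitions_mono[THEN monoD, of 0 "nat k"] by (simp add: partitions_extended_def)

lemma ind_pairs:
  assumes "\<And>i. a i \<le> b i" "\<And>i. b i \<le> a (Suc i)"
  shows "(\<Sum>i<K. nonneg_ind (M - a i) - nonneg_ind (M - b i)) \<in> {0..1}"
    and "(\<Sum>i<K. nonneg_ind (M - b i) - nonneg_ind (M - a (Suc i))) \<in> {0..1}"
proof -
  let ?f = "\<lambda>x. nonneg_ind (M - x)"
  have "(\<Sum>i<K. ?f (a i) - ?f (b i)) \<ge> 0" "(\<Sum>i<K. ?f (b i) - ?f (a (Suc i))) \<ge> 0"
    using assms by (auto intro!: sum_nonneg simp: nonneg_ind_def) (smt (verit))+
  moreover have "?f (a 0) - ?f (a K) \<le> 1" by (simp add: nonneg_ind_def)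
  ultimately show "(\<Sum>i<K. ?f (a i) - ?f (b i)) \<in> {0..1}" "(\<Sum>i<K. ?f (b i) - ?f (a (Suc i))) \<in> {0..1}"
    using alternating_sum[of ?f a b K] by auto
qed

text \<open>
  Together the two kinds of gaps collect the whole increment, so the first kind collects at least
  the share \<open>\<kappa>/(1 + \<kappa>)\<close>.
\<close>
lemma first_gaps_lower:
  fixes a b :: "nat \<Rightarrow> int" and \<kappa> :: real
  assumes ab: "\<And>i. a i \<le> b i" "\<And>i. b i \<le> a (Suc i)" and pos: "\<kappa> > 0"
    and gap: "\<And>i. \<kappa> * (a (Suc i) - b i) \<le> b i - a i" and K: "M \<le> a K"
  shows "\<kappa> * (partitions_extended (M - a 0) - 1) \<le>
           (1 + \<kappa>) * (\<Sum>i<K. partitions_of_int (M - a i) - partitions_of_int (M - b i))"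
proof -
  let ?X = "\<Sum>i<K. partitions_extended (M - a i) - partitions_extended (M - b i)"
  let ?Y = "\<Sum>i<K. partitions_extended (M - b i) - partitions_extended (M - a (Suc i))"
  have "\<kappa> * ?Y \<le> ?X"
    by (rule alternating_gaps[OF partitions_extended_convex mono_partitions_extended]) (use ab gap in auto)
  moreover have "?X + ?Y = partitions_extended (M - a 0) - 1"
    using alternating_sum[of "\<lambda>x. partitions_extended (M - x)" a b K] K by (simp add: partitions_extended_def)
  moreover have "(\<Sum>i<K. partitions_of_int (M - a i) - partitions_of_int (M - b i)) \<ge> ?X"
    using ind_pairs(1)[of a b M K, OF ab] by (simp add: partitions_of_int_conv sum.distrib sum_subtractf)
  then have "(1 + \<kappa>) * (\<Sum>i<K. partitions_of_int (M - a i) - partitions_of_int (M - b i)) \<ge> (1 + \<kappa>) * ?X"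
    using pos by (intro mult_left_mono) auto
  moreover have "\<kappa> * (partitions_extended (M - a 0) - 1) \<le> (1 + \<kappa>) * ?X"
    using calculation(1) unfolding calculation(2)[symmetric] distrib_left distrib_right mult_1 by linarith
  ultimately show ?thesis by linarith
qed

text \<open>
  Dually, the second kind collects at most the share \<open>1/(1 + \<kappa>)\<close>; the subtracted 1 absorbs the
  truncation at negative arguments.
\<close>
lemma second_gaps_upper:
  fixes a b :: "nat \<Rightarrow> int" and \<kappa> :: real
  assumes ab: "\<And>i. a i \<le> b i" "\<And>i. b i \<le> a (Suc i)" and pos: "\<kappa> > 0"
    and gap: "\<And>i. \<kappa> * (a (Suc i) - b i) \<le> b i - a i"
  shows "(1 + \<kappa>) * (real_of_int (\<Sum>i<K. partitions_of_int (M - b i) - partitions_of_int (M - a (Suc i))) - 1)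
           \<le> partitions_extended (M - a 0)"
proof -
  let ?X = "\<Sum>i<K. partitions_extended (M - a i) - partitions_extended (M - b i)"
  let ?Y = "\<Sum>i<K. partitions_extended (M - b i) - partitions_extended (M - a (Suc i))"
  have "\<kappa> * ?Y \<le> ?X"
    by (rule alternating_gaps[OF partitions_extended_convex mono_partitions_extended]) (use ab gap in auto)
  moreover have "?X + ?Y \<le> partitions_extended (M - a 0)"
    using alternating_sum[of "\<lambda>x. partitions_extended (M - x)" a b K] partitions_extended_ge_1[of "M - a K"] by simp
  moreover have "real_of_int (\<Sum>i<K. partitions_of_int (M - b i) - partitions_of_int (M - a (Suc i))) - 1 \<le> ?Y"
    using ind_pairs(2)[of a b M K, OF ab] by (simp add: partitions_of_int_conv sum.distrib sum_subtractf)
  then have "(1 + \<kappa>) * (real_of_int (\<Sum>i<K. partitions_of_int (M - b i) - partitions_of_int (M - a (Suc i))) - 1) \<le> (1 + \<kappa>) * ?Y"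
    using pos by (intro mult_left_mono) auto
  moreover have "(1 + \<kappa>) * ?Y \<le> ?X + ?Y"
    using calculation(1) unfolding distrib_left distrib_right mult_1 by linarith
  ultimately show ?thesis by linarith
qed

section \<open>Sign of the crank-rank sum\<close>

definition crank_exp :: "nat \<Rightarrow> nat \<Rightarrow> nat" where
  "crank_exp m r = r * (r + 1) div 2 + r * m"

text \<open>
  Half of the exponent \<open>3s\<^sup>2 + s + 2sm\<close>.
\<close>
definition rank_exp :: "nat \<Rightarrow> nat \<Rightarrow> nat" where
  "rank_exp m s = s * (3 * s + 1) div 2 + s * m"

text \<open>
  The coefficients of \<open>1/(q\<^sup>2;q\<^sup>2)\<^sub>\<infinity>\<close>.
\<close>
definition partitions_of_half :: "int \<Rightarrow> int" where
  "partitions_of_half k = (if even k then partitions_of_int (k div 2) else 0)"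

text \<open>
  The coefficient of \<open>q\<^sup>n\<close> in the closed form of \<open>D\<^sub>m\<close>. Terms with index above \<open>n\<close> vanish; the bound \<open>4n\<close> lets
  the crank sum be grouped by residues modulo 4.
\<close>
definition crank_rank_sum :: "nat \<Rightarrow> nat \<Rightarrow> int" where
  "crank_rank_sum m n = (\<Sum>r=1..4*n. (-1) ^ (r + 1) * partitions_of_half (int n - int (crank_exp m r)))
               + (\<Sum>s=1..4*n. (-1) ^ s * partitions_of_half (int n - 2 * int (rank_exp m s)))"

lemma sum_group4: "(\<Sum>r=1..4*n. f r) = (\<Sum>j<n. f (4*j+1) + f (4*j+2) + f (4*j+3) + f (4*j+4))"
  for f :: "nat \<Rightarrow> int"
proof (induction n)
  case (Suc n)
  have "4 * Suc n = Suc (Suc (Suc (Suc (4 * n))))" by simp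
  then show ?case using Suc by (simp add: eval_nat_numeral ac_simps)
qed simp

lemma sum_group2: "(\<Sum>r=1..2*n. f r) = (\<Sum>j<n. f (2*j+1) + f (2*j+2))"
  for f :: "nat \<Rightarrow> int"
  by (induction n) (simp_all add: ac_simps)

text \<open>
  The parity of these exponents depends on the residue of the index modulo 4 and on the parity of \<open>m\<close>.
\<close>
lemma crank_exp_mod4:
  "crank_exp m (4*j+1) = (4*j+1) * (2*j+1+m)"
  "crank_exp m (4*j+2) = (2*j+1) * (4*j+3+2*m)"
  "crank_exp m (4*j+3) = (4*j+3) * (2*j+2+m)"
  "crank_exp m (4*j+4) = (2*j+2) * (4*j+5+2*m)"
proof -
  have *: "r * (r + 1) div 2 + r * m = k" if "r * (r + 1) + 2 * r * m = 2 * k" for r k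
  proof -
    have "x div 2 + y = k" if "x + 2 * y = 2 * k" for x y k :: nat using that by presburger
    from this[of "r * (r + 1)" "r * m" k] show ?thesis using that by (simp only: mult.assoc)
  qed
  show "crank_exp m (4*j+1) = (4*j+1) * (2*j+1+m)"
    "crank_exp m (4*j+2) = (2*j+1) * (4*j+3+2*m)"
    "crank_exp m (4*j+3) = (4*j+3) * (2*j+2+m)"
    "crank_exp m (4*j+4) = (2*j+2) * (4*j+5+2*m)"
    unfolding crank_exp_def by (rule *, simp add: algebra_simps)+
qed

lemma rank_exp_Suc: "rank_exp m (Suc s) = rank_exp m s + (3 * s + 2 + m)"
proof -
  have "Suc s * (3 * Suc s + 1) = s * (3 * s + 1) + 2 * (3 * s + 2)" by (simp add: algebra_simps)
  then have "Suc s * (3 * Suc s + 1) div 2 = s * (3 * s + 1) div 2 + (3 * s + 2)"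
    by (simp only: div_mult_self2)
  then show ?thesis by (simp add: rank_exp_def)
qed

lemma rank_exp_0 [simp]: "rank_exp m 0 = 0" by (simp add: rank_exp_def)

lemma rank_exp_ge: "rank_exp m s \<ge> s"
  by (induction s) (auto simp: rank_exp_Suc)

lemma partitions_of_int_mono: "x \<le> y \<Longrightarrow> partitions_of_int x \<le> partitions_of_int y"
  using partitions_nonneg by (auto simp: partitions_of_int_def intro!: monoD[OF partitions_mono] nat_mono)

lemma partitions_of_int_strict: "x < y \<Longrightarrow> 2 \<le> y \<Longrightarrow> partitions_of_int x < partitions_of_int y"
proof -
  assume xy: "x < y" "2 \<le> y"
  have "partitions_of_int x \<le> partitions_of_int (y - 1)" using xy by (intro partitions_of_int_mono) auto
  also have "partitions_of_int (y - 1) < partitions_of_int y"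
  proof -
    have "nat (y - 1) \<ge> 1" "Suc (nat (y - 1)) = nat y" using xy by linarith+
    then show ?thesis using partitions_strict[of "nat (y - 1)"] xy by (simp add: partitions_of_int_def)
  qed
  finally show ?thesis .
qed

lemma partitions_of_half_even [simp]: "partitions_of_half (2 * k) = partitions_of_int k"
  by (simp add: partitions_of_half_def)

lemma partitions_of_half_odd: "odd k \<Longrightarrow> partitions_of_half k = 0"
  by (simp add: partitions_of_half_def)

lemma eventually_partitions_extended:
  assumes "\<epsilon> > 0"
  shows "eventually (\<lambda>n. (1 - \<epsilon>) * partitions_extended (int n) \<le> partitions_extended (int n - int c)) sequentially"
  using partitions_shift[OF assms, of c] by eventually_elim (simp add: partitions_extended_def flip: of_nat_diff; simp add: nat_diff_distrib')

lemma rank_sum_pairs: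
  "(\<Sum>s=1..4*n. (-1) ^ s * partitions_of_half (2 * M - 2 * int (rank_exp m s))) =
     - (\<Sum>i<2*n. partitions_of_int (M - rank_exp m (2*i+1)) - partitions_of_int (M - rank_exp m (2*i+2)))"
proof -
  have "(\<Sum>s=1..4*n. (-1) ^ s * partitions_of_half (2 * M - 2 * int (rank_exp m s)))
      = (\<Sum>s=1..2*(2*n). (-1) ^ s * partitions_of_int (M - int (rank_exp m s)))"
    unfolding right_diff_distrib[symmetric] partitions_of_half_even by simp
  then show ?thesis unfolding sum_group2 sum_negf[symmetric] by simp
qed

lemma rank_sum_odd:
  assumes "odd n"
  shows "(\<Sum>s=1..4*k. (-1) ^ s * partitions_of_half (n - 2 * int (rank_exp m s))) = 0"
  by (intro sum.neutral ballI) (use assms in \<open>simp add: partitions_of_half_odd\<close>)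

lemma crank_sum_group4:
  "(\<Sum>r=1..4*k. (-1) ^ (r + 1) * partitions_of_half (n - int (crank_exp m r))) =
   (\<Sum>j<k. (partitions_of_half (n - int (crank_exp m (4*j+1))) - partitions_of_half (n - int (crank_exp m (4*j+2))))
        + (partitions_of_half (n - int (crank_exp m (4*j+3))) - partitions_of_half (n - int (crank_exp m (4*j+4)))))"
  unfolding sum_group4 by (intro sum.cong refl) simp

text \<open>
  For even \<open>m\<close> the crank exponents that are even have index congruent to 3 or 0 modulo 4. The latter are
  written in terms of \<open>Suc j\<close>, so that with the exponent 0 of index 0 they form one sequence of breakpoints.
\<close>
lemma crank_sum_even_even:
  "(\<Sum>r=1..4*k. (-1) ^ (r + 1) * partitions_of_half (2 * M - int (crank_exp (2 * \<mu>) r))) =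
   (\<Sum>j<k. partitions_of_int (M - int ((4*j+3) * (j+1+\<mu>))) - partitions_of_int (M - int (Suc j * (4*Suc j+1+4*\<mu>))))"
  unfolding crank_sum_group4
proof (rule sum.cong[OF refl])
  fix j
  have "partitions_of_half (2 * M - int (crank_exp (2 * \<mu>) (4*j+1))) = 0"
       "partitions_of_half (2 * M - int (crank_exp (2 * \<mu>) (4*j+2))) = 0"
    unfolding crank_exp_mod4 by (rule partitions_of_half_odd, simp)+
  moreover have "2 * M - int (crank_exp (2 * \<mu>) (4*j+3)) = 2 * (M - int ((4*j+3) * (j+1+\<mu>)))"
       "2 * M - int (crank_exp (2 * \<mu>) (4*j+4)) = 2 * (M - int (Suc j * (4*Suc j+1+4*\<mu>)))"
    unfolding crank_exp_mod4 by (simp_all add: algebra_simps)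
  ultimately show "partitions_of_half (2 * M - int (crank_exp (2 * \<mu>) (4*j+1))) - partitions_of_half (2 * M - int (crank_exp (2 * \<mu>) (4*j+2)))
        + (partitions_of_half (2 * M - int (crank_exp (2 * \<mu>) (4*j+3))) - partitions_of_half (2 * M - int (crank_exp (2 * \<mu>) (4*j+4))))
     = partitions_of_int (M - int ((4*j+3) * (j+1+\<mu>))) - partitions_of_int (M - int (Suc j * (4*Suc j+1+4*\<mu>)))"
    by (simp only: partitions_of_half_even)
qed

text \<open>
  For odd \<open>m\<close> the indices congruent to 1 and 0 modulo 4 remain.
\<close>
lemma crank_sum_even_odd:
  "(\<Sum>r=1..4*k. (-1) ^ (r + 1) * partitions_of_half (2 * M - int (crank_exp (2 * \<mu> + 1) r))) =
   (\<Sum>j<k. partitions_of_int (M - int ((4*j+1) * (j+1+\<mu>))) - partitions_of_int (M - int ((j+1) * (4*j+7+4*\<mu>))))"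
  unfolding crank_sum_group4
proof (rule sum.cong[OF refl])
  fix j
  have "partitions_of_half (2 * M - int (crank_exp (2 * \<mu> + 1) (4*j+2))) = 0"
       "partitions_of_half (2 * M - int (crank_exp (2 * \<mu> + 1) (4*j+3))) = 0"
    unfolding crank_exp_mod4 by (rule partitions_of_half_odd, simp)+
  moreover have "2 * M - int (crank_exp (2 * \<mu> + 1) (4*j+1)) = 2 * (M - int ((4*j+1) * (j+1+\<mu>)))"
       "2 * M - int (crank_exp (2 * \<mu> + 1) (4*j+4)) = 2 * (M - int ((j+1) * (4*j+7+4*\<mu>)))"
    unfolding crank_exp_mod4 by (simp_all add: algebra_simps)
  ultimately show "partitions_of_half (2 * M - int (crank_exp (2 * \<mu> + 1) (4*j+1))) - partitions_of_half (2 * M - int (crank_exp (2 * \<mu> + 1) (4*j+2)))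
        + (partitions_of_half (2 * M - int (crank_exp (2 * \<mu> + 1) (4*j+3))) - partitions_of_half (2 * M - int (crank_exp (2 * \<mu> + 1) (4*j+4))))
     = partitions_of_int (M - int ((4*j+1) * (j+1+\<mu>))) - partitions_of_int (M - int ((j+1) * (4*j+7+4*\<mu>)))"
    by (simp only: partitions_of_half_even)
qed

lemma partitions_of_half_mono:
  assumes "even x" "even y" "x \<le> y"
  shows "partitions_of_half x \<le> partitions_of_half y"
  using assms unfolding partitions_of_half_def by (auto intro!: partitions_of_int_mono zdiv_mono1)

lemma partitions_of_half_strict:
  assumes "even x" "even y" "x < y" "4 \<le> y"
  shows "partitions_of_half x < partitions_of_half y"
  using assms unfolding partitions_of_half_def by (auto intro!: partitions_of_int_strict elim!: evenE)

lemma crank_exp_mono: "r \<le> s \<Longrightarrow> crank_exp m r \<le> crank_exp m s"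
  unfolding crank_exp_def by (intro add_mono div_le_mono mult_mono) auto

text \<open>
  Only the indices \<open>4j + 1\<close> and \<open>4j + 2\<close> survive, with signs plus and minus. For odd \<open>m\<close> below it is
  \<open>4j + 2\<close> and \<open>4j + 3\<close>, with the opposite signs.
\<close>
lemma crank_rank_sum_odd_even:
  assumes "odd n" "even m" "n > crank_exp m 2 + 4"
  shows "crank_rank_sum m n > 0"
proof -
  let ?h = "\<lambda>r. partitions_of_half (int n - int (crank_exp m r))"
  have "odd (int n)" using assms by simp
  obtain \<mu> where m: "m = 2 * \<mu>" using assms by (auto elim: evenE)
  have o: "odd (crank_exp m (4*j+1))" "odd (crank_exp m (4*j+2))"
          "even (crank_exp m (4*j+3))" "even (crank_exp m (4*j+4))" for j
    unfolding crank_exp_mod4 m by simp_all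
  have z: "?h (4*j+3) = 0" "?h (4*j+4) = 0" for j
    by (rule partitions_of_half_odd, use o[of j] assms in simp)+
  have g: "?h (4*j+1) - ?h (4*j+2) \<ge> 0" for j
    using partitions_of_half_mono[of "int n - int (crank_exp m (4*j+2))" "int n - int (crank_exp m (4*j+1))"]
      o[of j] assms crank_exp_mono[of "4*j+1" "4*j+2" m] by simp
  have "?h (4*0+1) - ?h (4*0+2) > 0"
    using partitions_of_half_strict[of "int n - int (crank_exp m (4*0+2))" "int n - int (crank_exp m (4*0+1))"]
      o[of 0] assms by (simp add: crank_exp_def)
  moreover have "(\<Sum>j\<in>{0}. ?h (4*j+1) - ?h (4*j+2)) \<le> (\<Sum>j<n. ?h (4*j+1) - ?h (4*j+2))"
    by (rule sum_mono2) (use g assms in auto)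
  ultimately have "(\<Sum>j<n. ?h (4*j+1) - ?h (4*j+2)) > 0" by simp
  then show ?thesis
    unfolding crank_rank_sum_def crank_sum_group4 rank_sum_odd[OF \<open>odd (int n)\<close>] z by simp
qed

lemma crank_rank_sum_odd_odd:
  assumes "odd n" "odd m" "n > crank_exp m 3 + 4"
  shows "crank_rank_sum m n < 0"
proof -
  let ?h = "\<lambda>r. partitions_of_half (int n - int (crank_exp m r))"
  have "odd (int n)" using assms by simp
  obtain \<mu> where m: "m = 2 * \<mu> + 1" using assms by (auto elim: oddE)
  have o: "even (crank_exp m (4*j+1))" "odd (crank_exp m (4*j+2))"
          "odd (crank_exp m (4*j+3))" "even (crank_exp m (4*j+4))" for j
    unfolding crank_exp_mod4 m by simp_all
  have z: "?h (4*j+1) = 0" "?h (4*j+4) = 0" for j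
    by (rule partitions_of_half_odd, use o[of j] assms in simp)+
  have g: "?h (4*j+2) - ?h (4*j+3) \<ge> 0" for j
    using partitions_of_half_mono[of "int n - int (crank_exp m (4*j+3))" "int n - int (crank_exp m (4*j+2))"]
      o[of j] assms crank_exp_mono[of "4*j+2" "4*j+3" m] by simp
  have "?h (4*0+2) - ?h (4*0+3) > 0"
    using partitions_of_half_strict[of "int n - int (crank_exp m (4*0+3))" "int n - int (crank_exp m (4*0+2))"]
      o[of 0] assms by (simp add: crank_exp_def)
  moreover have "(\<Sum>j\<in>{0}. ?h (4*j+2) - ?h (4*j+3)) \<le> (\<Sum>j<n. ?h (4*j+2) - ?h (4*j+3))"
    by (rule sum_mono2) (use g assms in auto)
  ultimately have "(\<Sum>j<n. ?h (4*j+2) - ?h (4*j+3)) > 0" by simp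
  moreover have "crank_rank_sum m n = - (\<Sum>j<n. ?h (4*j+2) - ?h (4*j+3))"
    unfolding crank_rank_sum_def crank_sum_group4 rank_sum_odd[OF \<open>odd (int n)\<close>] z sum_negf[symmetric] by simp
  ultimately show ?thesis by simp
qed

text \<open>
  The crank increments lie over gaps of length \<open>2(j+1) + \<mu>\<close>, each preceded by one of length
  \<open>6j + 3 + 3\<mu>\<close>, which is at least \<open>3/2\<close> times as long: their share is at most \<open>2/5\<close>. The rank gaps that
  begin at an odd \<open>s \<ge> 3\<close> are at least \<open>11/14\<close> times as long as the following ones: their share is at least
  \<open>11/25\<close>. Starting at \<open>s = 3\<close> matters, since from \<open>s = 1\<close> on the ratio \<open>5/8\<close> would only give \<open>5/13 < 2/5\<close>.
\<close>
lemma crank_rank_sum_even_even: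
  assumes "M > 0" and near: "99 / 100 * partitions_extended (int M) \<le> partitions_extended (int M - int (rank_exp (2 * \<mu>) 3))"
    and big: "partitions_extended (int M) \<ge> 100"
  shows "crank_rank_sum (2 * \<mu>) (2 * M) < 0"
proof -
  define m where "m = 2 * \<mu>"
  define a b where "a j = int (j * (4*j+1+4*\<mu>))" and "b j = int ((4*j+3) * (j+1+\<mu>))" for j
  define A where "A = (\<Sum>j<2*M. partitions_of_int (int M - b j) - partitions_of_int (int M - a (Suc j)))"
  define u where "u i = int (rank_exp m i)" for i
  define B0 where "B0 = partitions_of_int (int M - u 1) - partitions_of_int (int M - u 2)"
  define B where "B = (\<Sum>i<4*M-1. partitions_of_int (int M - u (2*i+3)) - partitions_of_int (int M - u (2*i+4)))"
  have A: "(1 + 3/2) * (real_of_int A - 1) \<le> partitions_extended (int M - a 0)"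
    unfolding A_def
    by (rule second_gaps_upper) (simp_all add: a_def b_def algebra_simps)
  have B: "11/14 * (partitions_extended (int M - u (2*0+3)) - 1) \<le> (1 + 11/14) * real_of_int B"
    unfolding B_def
  proof (rule first_gaps_lower)
    show "int M \<le> u (2 * (4 * M - 1) + 3)"
      using rank_exp_ge[of "2 * (4 * M - 1) + 3" m] assms unfolding u_def by linarith
  next
    fix i :: nat
    have s: "u (2*i+4) = u (2*i+3) + int (6*i+11+m)" "u (2*Suc i+3) = u (2*i+4) + int (6*i+14+m)"
      using rank_exp_Suc[of m "2*i+3"] rank_exp_Suc[of m "2*i+4"] unfolding u_def
      by (simp_all add: eval_nat_numeral)
    show "u (2*i+3) \<le> u (2*i+4)" "u (2*i+4) \<le> u (2*Suc i+3)"
      "11/14 * real_of_int (u (2*Suc i+3) - u (2*i+4)) \<le> real_of_int (u (2*i+4) - u (2*i+3))"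
      unfolding s by simp_all
  qed simp
  have "B0 \<ge> 0" unfolding B0_def u_def
    using rank_exp_Suc[of m 1] by (auto intro!: partitions_of_int_mono simp: numeral_2_eq_2)
  have "4 * M = Suc (4 * M - 1)" using assms by simp
  then have "(\<Sum>i<2*(2*M). partitions_of_int (int M - u (2*i+1)) - partitions_of_int (int M - u (2*i+2)))
      = (\<Sum>i<Suc (4*M-1). partitions_of_int (int M - u (2*i+1)) - partitions_of_int (int M - u (2*i+2)))" by simp
  also have "\<dots> = B0 + B"
    unfolding sum.lessThan_Suc_shift B0_def B_def by (simp add: eval_nat_numeral)
  finally have "crank_rank_sum m (2 * M) = A - (B0 + B)"
    using crank_sum_even_even[where k = "2*M" and M = "int M" and \<mu> = \<mu>] rank_sum_pairs[where n = "2*M" and M = "int M" and m = m]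
    unfolding crank_rank_sum_def A_def a_def b_def u_def m_def by simp
  moreover have "real_of_int A < real_of_int B"
    using A B near big unfolding m_def[symmetric] by (simp add: a_def u_def)
  then have "A < B" by simp
  ultimately show ?thesis using \<open>B0 \<ge> 0\<close> unfolding m_def by simp
qed

text \<open>
  Here the crank gaps \<open>6j + 6 + 3\<mu>\<close> are at least twice the following ones \<open>2j + 3 + \<mu>\<close>, so their share is at least
  \<open>2/3\<close>. Each rank gap that counts, other than the first, is preceded by one at least \<open>3/4\<close> as long, so these
  collect at most \<open>4/7 < 2/3\<close>; the first one is negligible because its length is fixed.
\<close>
lemma crank_rank_sum_even_odd:
  assumes "M > 0"
    and near: "99 / 100 * partitions_extended (int M) \<le> partitions_extended (int M - int (rank_exp (2 * \<mu> + 1) 2))"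
    and near': "99 / 100 * partitions_extended (int M) \<le> partitions_extended (int M - int (1 + \<mu>))"
    and big: "partitions_extended (int M) \<ge> 100"
    and M: "M \<ge> rank_exp (2 * \<mu> + 1) 2"
  shows "crank_rank_sum (2 * \<mu> + 1) (2 * M) > 0"
proof -
  define m where "m = 2 * \<mu> + 1"
  define a b where "a j = int ((4*j+1) * (j+1+\<mu>))" and "b j = int ((j+1) * (4*j+7+4*\<mu>))" for j
  define A where "A = (\<Sum>j<2*M. partitions_of_int (int M - a j) - partitions_of_int (int M - b j))"
  define u where "u i = int (rank_exp m i)" for i
  define B0 where "B0 = partitions_of_int (int M - u 1) - partitions_of_int (int M - u 2)"
  define B where "B = (\<Sum>i<4*M-1. partitions_of_int (int M - u (2*i+3)) - partitions_of_int (int M - u (2*Suc i+2)))"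
  have A: "2 * (partitions_extended (int M - a 0) - 1) \<le> (1 + 2) * real_of_int A"
    unfolding A_def
  proof (rule first_gaps_lower)
    have "2 * M * 1 \<le> (4*(2*M)+1) * (2*M+1+\<mu>)" by (intro mult_mono) auto
    then show "int M \<le> a (2 * M)" unfolding a_def by linarith
  qed (simp_all add: a_def b_def algebra_simps)
  have s: "u (2*i+3) = u (2*i+2) + int (6*i+8+m)" "u (2*Suc i+2) = u (2*i+3) + int (6*i+11+m)" for i
    using rank_exp_Suc[of m "2*i+2"] rank_exp_Suc[of m "2*i+3"] unfolding u_def
    by (simp_all add: eval_nat_numeral)
  have B: "(1 + 3/4) * (real_of_int B - 1) \<le> partitions_extended (int M - u (2*0+2))"
    unfolding B_def
    by (rule second_gaps_upper) (simp_all only: s, simp_all add: m_def)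
  have "partitions_extended (int M - u (2*0+2)) \<le> partitions_extended (int M)"
    by (rule monoD[OF mono_partitions_extended]) (simp add: u_def)
  have "partitions_of_int (int M - u 1) \<le> partitions_of_int (int M)"
    by (rule partitions_of_int_mono) (simp add: u_def)
  then have "real_of_int B0 \<le> real_of_int (partitions_of_int (int M)) - real_of_int (partitions_of_int (int M - u 2))"
    unfolding B0_def by simp
  also have "\<dots> = partitions_extended (int M) - partitions_extended (int M - u 2)"
    using M by (simp add: partitions_of_int_conv nonneg_ind_def u_def m_def)
  finally have B0: "real_of_int B0 \<le> partitions_extended (int M) - partitions_extended (int M - u 2)" .
  have "4 * M = Suc (4 * M - 1)" using assms by simp
  then have "(\<Sum>i<2*(2*M). partitions_of_int (int M - u (2*i+1)) - partitions_of_int (int M - u (2*i+2)))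
      = (\<Sum>i<Suc (4*M-1). partitions_of_int (int M - u (2*i+1)) - partitions_of_int (int M - u (2*i+2)))" by simp
  also have "\<dots> = B0 + B"
    unfolding sum.lessThan_Suc_shift B0_def B_def by (simp add: eval_nat_numeral)
  finally have "crank_rank_sum m (2 * M) = A - (B0 + B)"
    using crank_sum_even_odd[where k = "2*M" and M = "int M" and \<mu> = \<mu>] rank_sum_pairs[where n = "2*M" and M = "int M" and m = m]
    unfolding crank_rank_sum_def A_def a_def b_def u_def m_def by simp
  moreover have "real_of_int A > real_of_int B + real_of_int B0"
    using A B B0 near near' big \<open>partitions_extended (int M - u (2*0+2)) \<le> partitions_extended (int M)\<close>
    unfolding m_def[symmetric] by (simp add: a_def u_def)
  then have "A > B + B0" by linarith
  ultimately show ?thesis unfolding m_def by simp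
qed

theorem crank_rank_sum_sign: "\<exists>n0. \<forall>n\<ge>n0. (-1) ^ (m + n + 1) * crank_rank_sum m n > 0"
proof -
  define \<mu> where "\<mu> = m div 2"
  \<comment> \<open>One percent is small against the slack in \<open>2/5 < 11/25\<close> and in \<open>4/7 < 2/3\<close>, and so is the additive constant once \<open>p(M)\<close> is at least 100.\<close>
  have near: "eventually (\<lambda>M. 99 / 100 * partitions_extended (int M) \<le> partitions_extended (int M - int c)) sequentially" for c
    using eventually_partitions_extended[of "1/100" c] by simp
  have "eventually (\<lambda>M. 99 / 100 * partitions_extended (int M) \<le> partitions_extended (int M - int (rank_exp m 3))
      \<and> 99 / 100 * partitions_extended (int M) \<le> partitions_extended (int M - int (rank_exp m 2))
      \<and> 99 / 100 * partitions_extended (int M) \<le> partitions_extended (int M - int (1 + \<mu>))) sequentially"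
    by (intro eventually_conj near)
  then obtain M0 where M0: "\<And>M. M \<ge> M0 \<Longrightarrow> 99 / 100 * partitions_extended (int M) \<le> partitions_extended (int M - int (rank_exp m 3))
      \<and> 99 / 100 * partitions_extended (int M) \<le> partitions_extended (int M - int (rank_exp m 2))
      \<and> 99 / 100 * partitions_extended (int M) \<le> partitions_extended (int M - int (1 + \<mu>))"
    unfolding eventually_sequentially by blast
  have big: "partitions_extended (int M) \<ge> 100" if "M \<ge> 100" for M
    using partitions_ge[of M] that by (simp add: partitions_extended_def)
  show ?thesis
  proof (intro exI allI impI)
    fix n assume n: "n \<ge> 2 * (M0 + 100 + rank_exp m 2 + crank_exp m 3)"
    have c: "crank_exp m 2 \<le> crank_exp m 3" by (rule crank_exp_mono) simp
    show "(-1) ^ (m + n + 1) * crank_rank_sum m n > 0"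
    proof (cases "even n")
      case True
      then obtain M where M: "n = 2 * M" by (auto elim: evenE)
      then have "M \<ge> M0" "M \<ge> 100" "M \<ge> rank_exp m 2" using n by simp_all
      note facts = this M0[OF this(1)] big[OF this(2)]
      show ?thesis
      proof (cases "even m")
        case True
        then have m: "m = 2 * \<mu>" by (simp add: \<mu>_def)
        then show ?thesis using crank_rank_sum_even_even[of M \<mu>] facts M by simp
      next
        case False
        then have m: "m = 2 * \<mu> + 1" by (simp add: \<mu>_def)
        then show ?thesis using crank_rank_sum_even_odd[of M \<mu>] facts M by simp
      qed
    next
      case False
      then show ?thesis
        using crank_rank_sum_odd_even[of n m] crank_rank_sum_odd_odd[of n m] n c
        by (cases "even m") auto
    qed
  qed
qed

section \<open>Power series agreeing up to a degree\<close>

text \<open>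
  Congruence modulo \<open>q\<^bsup>N+1\<^esup>\<close>. Working with it replaces the infinite sums and products by finite ones.
\<close>

definition agree_upto :: "nat \<Rightarrow> 'a::comm_ring_1 fps \<Rightarrow> 'a fps \<Rightarrow> bool" where
  "agree_upto N f g \<longleftrightarrow> (\<forall>j\<le>N. fps_nth f j = fps_nth g j)"

lemma agree_upto_refl [simp]: "agree_upto N f f" by (simp add: agree_upto_def)
lemma agree_upto_sym: "agree_upto N f g \<Longrightarrow> agree_upto N g f" by (simp add: agree_upto_def)
lemma agree_upto_trans [trans]: "agree_upto N f g \<Longrightarrow> agree_upto N g h \<Longrightarrow> agree_upto N f h" by (simp add: agree_upto_def)
lemma agree_upto_mult: "agree_upto N f g \<Longrightarrow> agree_upto N f' g' \<Longrightarrow> agree_upto N (f * f') (g * g')"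
  unfolding agree_upto_def fps_mult_nth by (intro allI impI sum.cong refl) (auto intro!: arg_cong2[of _ _ _ _ "(*)"])
lemma agree_upto_diff: "agree_upto N f g \<Longrightarrow> agree_upto N f' g' \<Longrightarrow> agree_upto N (f - f') (g - g')"
  by (simp add: agree_upto_def)
lemma agree_upto_sum: "(\<And>i. i \<in> A \<Longrightarrow> agree_upto N (f i) (g i)) \<Longrightarrow> agree_upto N (sum f A) (sum g A)"
  by (simp add: agree_upto_def fps_sum_nth)
lemma agree_upto_prod: "(\<And>i. i \<in> A \<Longrightarrow> agree_upto N (f i) (g i)) \<Longrightarrow> agree_upto N (prod f A) (prod g A)"
  by (induction A rule: infinite_finite_induct) (auto intro: agree_upto_mult)

lemma agree_upto_recip:
  assumes "agree_upto N f g" "fps_nth f 0 = 1" "fps_nth g 0 = 1"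
  shows "agree_upto N (recip f) (recip g)"
proof -
  have "agree_upto N (recip f * g * recip g) (recip f * f * recip g)"
    by (intro agree_upto_mult agree_upto_refl agree_upto_sym[OF assms(1)])
  moreover have "recip f * g * recip g = recip f * (g * recip g)"
    "recip f * f * recip g = (f * recip f) * recip g" by (simp_all only: mult_ac)
  ultimately show ?thesis using mult_recip[OF assms(2)] mult_recip[OF assms(3)] by simp
qed

lemma agree_upto_X_power:
  assumes "agree_upto (N - k) f g" "k \<le> N"
  shows "agree_upto N (fps_X ^ k * f) (fps_X ^ k * g)"
  using assms unfolding agree_upto_def fps_X_power_mult_nth by (auto simp: le_diff_conv)

lemma agree_upto_X_power_0: "k > N \<Longrightarrow> agree_upto N (f * fps_X ^ k) 0"
  by (simp add: agree_upto_def fps_X_power_mult_right_nth)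

lemma qpoch_lessThan: "qpoch a b n = (\<Prod>k<n. 1 - a * b ^ k)"
  unfolding qpoch_def by (rule prod.reindex_bij_witness[of _ Suc "\<lambda>k. k - 1"]) auto

lemma qpoch_Suc: "qpoch a b (Suc n) = qpoch a b n * (1 - a * b ^ n)"
  by (simp add: qpoch_lessThan)

lemma qpoch_0 [simp]: "qpoch a b 0 = 1" by (simp add: qpoch_def)

lemma qpoch_inf_agree:
  fixes a b :: "'a::idom fps"
  assumes "fps_nth a 0 = 0" "fps_nth b 0 = 0" "N \<le> n"
  shows "agree_upto N (qpoch_inf a b) (qpoch a b n)"
proof -
  have stable: "agree_upto N (qpoch a b k) (qpoch a b n)" if "k \<ge> n" for k
    using that
  proof (induction k rule: dec_induct)
    case (step k)
    have "agree_upto N (1 - a * b ^ k) 1"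
      using fps_nth_mult_power_eq_0[OF assms(1,2)] step assms(3) by (simp add: agree_upto_def)
    then have "agree_upto N (qpoch a b k * (1 - a * b ^ k)) (qpoch a b n * 1)"
      by (rule agree_upto_mult[OF step.IH])
    then show ?case by (simp add: qpoch_Suc)
  qed simp
  show ?thesis unfolding agree_upto_def
  proof (intro allI impI)
    fix j assume "j \<le> N"
    have "(\<lambda>k. qpoch a b k) \<longlonglongrightarrow> qpoch_inf a b"
      unfolding qpoch_lessThan by (intro has_prod_imp_tendsto' qpoch_inf_has_prod assms)
    then have "\<forall>\<^sub>F k in sequentially. fps_nth (qpoch a b k) j = fps_nth (qpoch_inf a b) j"
      unfolding tendsto_fps_iff by blast
    then have "\<forall>\<^sub>F k in sequentially. fps_nth (qpoch a b n) j = fps_nth (qpoch_inf a b) j"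
      using eventually_ge_at_top[of n]
    proof eventually_elim
      case (elim k)
      then show ?case using stable[of k] \<open>j \<le> N\<close> by (simp add: agree_upto_def)
    qed
    then show "fps_nth (qpoch_inf a b) j = fps_nth (qpoch a b n) j" by simp
  qed
qed

lemma qpoch_inf_Suc:
  fixes a b :: "'a::idom fps"
  assumes "fps_nth a 0 = 0" "fps_nth b 0 = 0"
  shows "qpoch_inf a b = (1 - a) * qpoch_inf (a * b) b"
proof (rule fps_ext)
  fix N
  have "agree_upto N (qpoch_inf a b) (qpoch a b (Suc N))" using assms by (intro qpoch_inf_agree) auto
  also have "qpoch a b (Suc N) = (1 - a) * qpoch (a * b) b N"
    unfolding qpoch_lessThan prod.lessThan_Suc_shift by (simp add: mult_ac)
  also have "agree_upto N \<dots> ((1 - a) * qpoch_inf (a * b) b)"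
    using assms by (intro agree_upto_mult agree_upto_refl agree_upto_sym[OF qpoch_inf_agree]) auto
  finally show "fps_nth (qpoch_inf a b) N = fps_nth ((1 - a) * qpoch_inf (a * b) b) N"
    by (simp add: agree_upto_def)
qed

lemma qpoch_inf_agree_1:
  fixes a b :: "'a::idom fps"
  assumes "agree_upto N a 0" "fps_nth b 0 = 0"
  shows "agree_upto N (qpoch_inf a b) 1"
proof -
  have "agree_upto N (qpoch_inf a b) (\<Prod>k<N. 1 - a * b ^ k)"
    unfolding qpoch_lessThan[symmetric] using assms by (intro qpoch_inf_agree) (auto simp: agree_upto_def)
  also have "agree_upto N \<dots> (\<Prod>k<N. 1 - 0 * b ^ k)"
    by (intro agree_upto_prod agree_upto_diff agree_upto_mult agree_upto_refl assms)
  finally show ?thesis by simp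
qed

section \<open>Two Bailey pairs\<close>

text \<open>
  The cancelled quotient \<open>(z)\<^sub>n (1/z)\<^sub>n / ((z)\<^sub>\<infinity> (1/z)\<^sub>\<infinity>)\<close>.
\<close>

definition recip_tails :: "nat \<Rightarrow> laurent_poly fps" where
  "recip_tails n = recip (qpoch_inf (z_pow 1 * qX ^ n) qX * qpoch_inf (z_pow (-1) * qX ^ n) qX)"

lemma recip_tails_step:
  assumes "n \<ge> 1"
  shows "recip_tails n * ((1 - z_pow 1 * qX ^ n) * (1 - z_pow (-1) * qX ^ n)) = recip_tails (Suc n)"
proof -
  define f where "f n = qpoch_inf (z_pow 1 * qX ^ n) qX * qpoch_inf (z_pow (-1) * qX ^ n) qX" for n
  define D where "D = (1 - z_pow 1 * qX ^ n) * (1 - z_pow (-1) * qX ^ n)"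
  have f: "f k * recip_tails k = 1" if "k \<ge> 1" for k
    unfolding f_def recip_tails_def using that by (intro mult_recip) (simp add: fps_nth_qpoch_inf_0)
  have "f n = D * f (Suc n)"
    unfolding f_def D_def using assms
    by (subst (1 2) qpoch_inf_Suc) (simp_all add: mult_ac)
  then have "recip_tails n * D * (f (Suc n) * recip_tails (Suc n)) = (f n * recip_tails n) * recip_tails (Suc n)" by (simp add: mult_ac)
  then show ?thesis using f[of n] f[of "Suc n"] assms unfolding D_def by simp
qed

lemma recip_tails_agree: "agree_upto N (recip_tails (Suc N)) 1"
proof -
  have "agree_upto N (recip_tails (Suc N)) (recip 1)" unfolding recip_tails_def
  proof (rule agree_upto_recip)
    have "agree_upto N (qpoch_inf (z_pow 1 * qX ^ Suc N) qX * qpoch_inf (z_pow (-1) * qX ^ Suc N) qX) (1 * 1)"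
      by (intro agree_upto_mult qpoch_inf_agree_1 agree_upto_X_power_0) auto
    then show "agree_upto N (qpoch_inf (z_pow 1 * qX ^ Suc N) qX * qpoch_inf (z_pow (-1) * qX ^ Suc N) qX) 1" by simp
  qed (simp_all add: fps_nth_qpoch_inf_0)
  also have "recip 1 = (1 :: laurent_poly fps)" using mult_recip[of "1 :: laurent_poly fps"] by simp
  finally show ?thesis .
qed

text \<open>
  \<open>1/(q)\<^sub>k\<close>, with the usual convention that it is 0 for negative \<open>k\<close>. The convention makes
  \<open>recip_qfact_pred\<close> hold at 0 and terminates all sums over \<open>r\<close> below.
\<close>
definition recip_qfact :: "int \<Rightarrow> 'a::idom fps" where
  "recip_qfact k = (if k < 0 then 0 else recip (qpoch fps_X fps_X (nat k)))"

lemma recip_qfact_neg [simp]: "k < 0 \<Longrightarrow> recip_qfact k = 0" by (simp add: recip_qfact_def)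

lemma recip_qfact_mult: "qpoch fps_X fps_X n * recip_qfact (int n) = 1"
  unfolding recip_qfact_def by (simp add: mult_recip fps_nth_qpoch_0)

lemma recip_qfact_0 [simp]: "recip_qfact 0 = 1"
  using recip_qfact_mult[of 0] by simp

lemma recip_qfact_pred: "recip_qfact (int n - 1) = (1 - fps_X ^ n) * recip_qfact (int n)"
proof (cases n)
  case (Suc k)
  have "recip_qfact (int k) = recip_qfact (int k) * (qpoch fps_X fps_X n * recip_qfact (int n))"
    by (simp add: recip_qfact_mult)
  also have "\<dots> = (qpoch fps_X fps_X k * recip_qfact (int k)) * (1 - fps_X ^ n) * recip_qfact (int n)"
    by (simp add: Suc qpoch_Suc mult_ac)
  also have "\<dots> = (1 - fps_X ^ n) * recip_qfact (int n)" by (simp only: recip_qfact_mult mult_1)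
  finally show ?thesis by (simp add: Suc)
qed simp

text \<open>
  The \<open>\<alpha>\<close>-parts of the unit Bailey pair and of Slater's pair C(1), both relative to 1. The sequence of the latter is supported
  on even indices; \<open>slater_alpha s\<close> is its term with index \<open>2s\<close>.
\<close>
definition unit_alpha :: "nat \<Rightarrow> 'a::idom fps" where
  "unit_alpha r = (if r = 0 then 1 else (-1) ^ r * fps_X ^ (r * (r - 1) div 2) * (1 + fps_X ^ r))"

definition slater_alpha :: "nat \<Rightarrow> 'a::idom fps" where
  "slater_alpha s = (if s = 0 then 1 else (-1) ^ s * fps_X ^ (s * (3 * s - 1)) * (1 + fps_X ^ (2 * s)))"

lemma slater_alpha_0 [simp]: "slater_alpha 0 = 1" by (simp add: slater_alpha_def)

text \<open>
  The sum over \<open>r\<close> is indefinitely summable after multiplication by \<open>1 - q\<^sup>n\<close>; the closed form contains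
  \<open>1/(q)\<^bsub>n-k-1\<^esub>\<close> and therefore vanishes at \<open>k = n\<close>.
\<close>
lemma unit_partial_sum:
  assumes "n \<ge> 1"
  shows "(1 - fps_X ^ n) * (\<Sum>r\<le>k. unit_alpha r * recip_qfact (int n - int r) * recip_qfact (int n + int r)) =
     (-1) ^ k * fps_X ^ (k * (k + 1) div 2) * recip_qfact (int n - int k - 1) * recip_qfact (int n + int k)"
proof (induction k)
  case 0
  then show ?case by (simp add: unit_alpha_def recip_qfact_pred)
next
  case (Suc k)
  show ?case
  proof (cases "Suc k \<le> n")
    case False
    then show ?thesis using Suc by simp
  next
    case True
    define t where "t = n - Suc k"
    have n: "n = Suc k + t" using True by (simp add: t_def)
    define p w :: "'a fps" where "p = recip_qfact (int t)" and "w = recip_qfact (int (n + Suc k))"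
    have eqs: "int n - int k - 1 = int t" "int n - int (Suc k) = int t"
      "int n - int (Suc k) - 1 = int t - 1" "int n + int k = int (n + Suc k) - 1" "int n + int (Suc k) = int (n + Suc k)"
      using n by simp_all
    define E where "E = k * (k + 1) div 2"
    have T: "Suc k * (Suc k + 1) div 2 = E + Suc k" "Suc k * (Suc k - 1) div 2 = E"
      using div_mult_self2[of 2 "k * (k + 1)" "Suc k"] by (simp_all add: algebra_simps E_def)
    have al: "unit_alpha (Suc k) = (-1) ^ Suc k * fps_X ^ E * (1 + fps_X ^ Suc k :: 'a fps)"
      unfolding unit_alpha_def T by simp
    show ?thesis
      unfolding sum.atMost_Suc T al
      unfolding distrib_left Suc.IH[folded E_def] eqs recip_qfact_pred p_def[symmetric] w_def[symmetric]
      by (simp add: n algebra_simps power_add)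
  qed
qed

lemma unit_pair:
  assumes "n \<ge> 1"
  shows "(\<Sum>r\<le>n. unit_alpha r * recip_qfact (int n - int r) * recip_qfact (int n + int r)) = (0 :: 'a::idom fps)"
proof -
  have "fps_nth (1 - fps_X ^ n :: 'a fps) 0 \<noteq> 0" using assms by simp
  then have "1 - fps_X ^ n \<noteq> (0 :: 'a fps)" by force
  then show ?thesis using unit_partial_sum[OF assms, of n, where 'a = 'a] by simp
qed

text \<open>
  A creative telescoping certificate: the sums over \<open>s\<close> satisfy the recurrence in \<open>n\<close> that
  \<open>1/((q;q\<^sup>2)\<^sub>n (q)\<^sub>n)\<close> satisfies, up to a boundary term that vanishes for large \<open>k\<close>. In the induction step,
  \<open>x = q\<^sup>k\<close> and \<open>y = q\<^sup>t\<close> with \<open>t = n + 1 - 2(k + 1)\<close> turn the claim into a polynomial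
  identity.
\<close>
lemma slater_partial_sum:
  "(1 - fps_X ^ Suc n) * (1 - fps_X ^ (2 * n + 1)) *
       (\<Sum>s\<le>k. slater_alpha s * recip_qfact (int (Suc n) - 2 * int s) * recip_qfact (int (Suc n) + 2 * int s)) -
     (\<Sum>s\<le>k. slater_alpha s * recip_qfact (int n - 2 * int s) * recip_qfact (int n + 2 * int s)) =
     (-1) ^ k * fps_X ^ (3 * k * (k + 1) + Suc n) * recip_qfact (int (Suc n) - 2 * int k - 2) * recip_qfact (int (Suc n) + 2 * int k)"
proof (induction k)
  case 0
  define Q x :: "'a fps" where "Q = recip_qfact (int (Suc n))" and "x = fps_X ^ n"
  have pow: "fps_X ^ Suc n = fps_X * x" "fps_X ^ (2 * n + 1) = fps_X * x ^ 2"
    by (simp_all add: x_def power_even_eq)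
  have i1: "recip_qfact (int n) = (1 - fps_X * x) * Q" using recip_qfact_pred[of "Suc n"] by (simp add: Q_def x_def)
  have i2: "recip_qfact (int (Suc n) - 2) = (1 - x) * ((1 - fps_X * x) * Q)"
    using recip_qfact_pred[of n] unfolding i1[symmetric] by (simp add: x_def)
  have "(1 - fps_X * x) * (1 - fps_X * x ^ 2) * (Q * Q) - ((1 - fps_X * x) * Q) * ((1 - fps_X * x) * Q)
     = fps_X * x * ((1 - x) * ((1 - fps_X * x) * Q)) * Q" by algebra
  then show ?case unfolding pow
    by (simp only: atMost_0 sum.insert finite.emptyI sum.empty slater_alpha_0 of_nat_0 mult_zero_right
        empty_iff not_False_eq_True add_0_right diff_0_right power_0 mult_1 add_0 mult_zero_left
        i1 i2 Q_def[symmetric] pow)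
next
  case (Suc k)
  show ?case
  proof (cases "2 * Suc k \<le> Suc n")
    case False
    then show ?thesis using Suc by simp
  next
    case True
    define t where "t = Suc n - 2 * Suc k"
    have n: "Suc n = 2 * Suc k + t" using True by (simp add: t_def)
    define p w :: "'a fps" where "p = recip_qfact (int t)" and "w = recip_qfact (int (Suc n + 2 * Suc k))"
    have e: "int n = int (Suc n) - 1" by simp
    have p: "recip_qfact (int (Suc n) - 2 * int (Suc k)) = p" "recip_qfact (int (Suc n) - 2 * int k - 2) = p"
            "recip_qfact (int n - 2 * int (Suc k)) = (1 - fps_X ^ t) * p"
            "recip_qfact (int (Suc n) - 2 * int (Suc k) - 2) = (1 - fps_X ^ (t - 1)) * (1 - fps_X ^ t) * p"
    proof -
      have "int (Suc n) - 2 * int (Suc k) = int t" "int (Suc n) - 2 * int k - 2 = int t"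
         "int n - 2 * int (Suc k) = int t - 1" using n by simp_all
      then show "recip_qfact (int (Suc n) - 2 * int (Suc k)) = p" "recip_qfact (int (Suc n) - 2 * int k - 2) = p"
            "recip_qfact (int n - 2 * int (Suc k)) = (1 - fps_X ^ t) * p" by (simp_all only: p_def recip_qfact_pred)
      show "recip_qfact (int (Suc n) - 2 * int (Suc k) - 2) = (1 - fps_X ^ (t - 1)) * (1 - fps_X ^ t) * p"
      proof (cases t)
        case 0
        then show ?thesis using n by simp
      next
        case (Suc t')
        then have "int (Suc n) - 2 * int (Suc k) - 2 = int t' - 1" using n by simp
        moreover have "recip_qfact (int t') = (1 - fps_X ^ Suc t') * (recip_qfact (int (Suc t')) :: 'a fps)"
          using recip_qfact_pred[of "Suc t'"] by simp
        ultimately show ?thesis by (simp only: p_def recip_qfact_pred Suc diff_Suc_1 mult.assoc)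
      qed
    qed
    have w: "recip_qfact (int (Suc n) + 2 * int (Suc k)) = w"
       "recip_qfact (int n + 2 * int (Suc k)) = (1 - fps_X ^ (Suc n + 2 * Suc k)) * w"
       "recip_qfact (int (Suc n) + 2 * int k) = (1 - fps_X ^ (Suc n + 2 * k + 1)) * (1 - fps_X ^ (Suc n + 2 * Suc k)) * w"
    proof -
      have "int (Suc n) + 2 * int (Suc k) = int (Suc n + 2 * Suc k)"
         "int n + 2 * int (Suc k) = int (Suc n + 2 * Suc k) - 1"
         by simp_all
      then show "recip_qfact (int (Suc n) + 2 * int (Suc k)) = w"
       "recip_qfact (int n + 2 * int (Suc k)) = (1 - fps_X ^ (Suc n + 2 * Suc k)) * w" by (simp_all only: w_def recip_qfact_pred)
      have e: "int (Suc n) + 2 * int k = int (Suc n + 2 * k + 1) - 1"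
         "int (Suc n + 2 * k + 1) = int (Suc n + 2 * Suc k) - 1" by simp_all
      have "recip_qfact (int (Suc n + 2 * k + 1)) = (1 - fps_X ^ (Suc n + 2 * Suc k)) * w"
        unfolding e(2) w_def by (rule recip_qfact_pred)
      then show "recip_qfact (int (Suc n) + 2 * int k) = (1 - fps_X ^ (Suc n + 2 * k + 1)) * (1 - fps_X ^ (Suc n + 2 * Suc k)) * w"
        unfolding e(1) recip_qfact_pred by (simp only: mult.assoc)
    qed
    define x y :: "'a fps" where "x = fps_X ^ k" and "y = fps_X ^ t"
    \<comment> \<open>Up to powers of \<open>x\<close>, \<open>y\<close> and \<open>q\<close>, \<open>G\<close> is a common factor of all terms.\<close>
    define G :: "'a fps" where "G = (-1) ^ k * fps_X ^ (3 * k * (k + 1)) * p * w"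
    have "Suc n = 2 * k + 2 + t" using n by simp
    then have pow: "fps_X ^ Suc n = x^2 * fps_X^2 * y" "fps_X ^ (2*n+1) = fps_X ^ 3 * x^4 * y^2"
       "fps_X ^ (Suc n + 2 * Suc k) = x^4 * fps_X^4 * y" "fps_X ^ (Suc n + 2 * k + 1) = x^4 * fps_X^3 * y"
       "fps_X ^ (2 * Suc k) = x^2 * fps_X^2"
      unfolding x_def y_def power_mult[symmetric] power_add[symmetric]
      by - (rule arg_cong[where f = "\<lambda>i. fps_X ^ i"], use n in simp)+
    have al: "slater_alpha (Suc k) * p * w = - (fps_X^2 * x^2 * (1 + x^2 * fps_X^2) * G)"
    proof -
      have "Suc k * (3 * Suc k - 1) = 3 * k * (k + 1) + (2 * k + 2)" by (simp add: algebra_simps)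
      then show ?thesis unfolding slater_alpha_def pow(5) G_def
        by (simp add: x_def power_add power_mult power2_eq_square mult_ac)
    qed
    have g0: "(-1) ^ k * fps_X ^ (3 * k * (k + 1) + Suc n) * p * w = x^2 * fps_X^2 * y * G"
      unfolding power_add pow(1) G_def by (simp add: mult_ac)
    have g1: "(-1) ^ Suc k * fps_X ^ (3 * Suc k * (Suc k + 1) + Suc n) * p * w = - (fps_X^6 * x^6 * (x^2 * fps_X^2 * y) * G)"
    proof -
      have "3 * Suc k * (Suc k + 1) = 3 * k * (k + 1) + (6 * k + 6)" by (simp add: algebra_simps)
      then show ?thesis unfolding power_add pow(1) G_def
        by (simp add: x_def power_add power_mult[symmetric] mult_ac)
    qed
    have key: "x^2 * fps_X^2 * y * (1 - x^4 * fps_X^3 * y) * (1 - x^4 * fps_X^4 * y) * G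
       - fps_X^2 * x^2 * (1 + x^2 * fps_X^2) * G * ((1 - x^2 * fps_X^2 * y) * (1 - fps_X ^ 3 * x^4 * y^2)
           - (1 - y) * (1 - x^4 * fps_X^4 * y))
       = - (fps_X^6 * x^6 * (x^2 * fps_X^2 * y) * G) * ((1 - fps_X ^ (t - 1)) * (1 - y))"
    proof (cases t)
      case 0
      then have "y = 1" by (simp add: y_def)
      then show ?thesis unfolding \<open>y = 1\<close> diff_self mult_zero_right power_one mult_1_right by algebra
    next
      case (Suc t')
      define c :: "'a fps" where "c = fps_X ^ t'"
      have "y = fps_X * c" by (simp add: y_def c_def Suc)
      then show ?thesis unfolding Suc diff_Suc_1 c_def[symmetric] by algebra
    qed
    have "(1 - fps_X ^ Suc n) * (1 - fps_X ^ (2 * n + 1)) *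
       (\<Sum>s\<le>Suc k. slater_alpha s * recip_qfact (int (Suc n) - 2 * int s) * recip_qfact (int (Suc n) + 2 * int s)) -
     (\<Sum>s\<le>Suc k. slater_alpha s * recip_qfact (int n - 2 * int s) * recip_qfact (int n + 2 * int s))
     = ((-1) ^ k * fps_X ^ (3 * k * (k + 1) + Suc n) * p * w) * (1 - x^4 * fps_X^3 * y) * (1 - x^4 * fps_X^4 * y)
       + (slater_alpha (Suc k) * p * w) * ((1 - x^2 * fps_X^2 * y) * (1 - fps_X ^ 3 * x^4 * y^2)
           - (1 - y) * (1 - x^4 * fps_X^4 * y))"
      using Suc.IH unfolding sum.atMost_Suc p w pow y_def[symmetric] by (simp add: algebra_simps)
    also have "\<dots> = - (fps_X^6 * x^6 * (x^2 * fps_X^2 * y) * G) * ((1 - fps_X ^ (t - 1)) * (1 - y))"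
      unfolding al g0 key[symmetric] by (simp add: algebra_simps)
    also have "\<dots> = ((-1) ^ Suc k * fps_X ^ (3 * Suc k * (Suc k + 1) + Suc n) * p * w) * ((1 - fps_X ^ (t - 1)) * (1 - y))"
      by (simp only: g1)
    also have "\<dots> = (-1) ^ Suc k * fps_X ^ (3 * Suc k * (Suc k + 1) + Suc n) *
       recip_qfact (int (Suc n) - 2 * int (Suc k) - 2) * recip_qfact (int (Suc n) + 2 * int (Suc k))"
      unfolding p w y_def by (simp only: mult_ac)
    finally show ?thesis .
  qed
qed

definition slater_beta :: "nat \<Rightarrow> 'a::idom fps" where
  "slater_beta n = recip (qpoch fps_X (fps_X ^ 2) n * qpoch fps_X fps_X n)"

lemma one_minus_nonzero: "n \<ge> 1 \<Longrightarrow> 1 - fps_X ^ n \<noteq> (0 :: 'a::idom fps)"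
proof
  assume "n \<ge> 1" "1 - fps_X ^ n = (0 :: 'a fps)"
  moreover have "fps_nth (1 - fps_X ^ n :: 'a fps) 0 = 1" using \<open>n \<ge> 1\<close> by simp
  ultimately show False by (simp only: fps_zero_nth zero_neq_one)
qed

lemma slater_pair: "(\<Sum>s\<le>n. slater_alpha s * recip_qfact (int n - 2 * int s) * recip_qfact (int n + 2 * int s)) = (slater_beta n :: 'a::idom fps)"
proof -
  define S where "S n k = (\<Sum>s\<le>k. slater_alpha s * recip_qfact (int n - 2 * int s) * recip_qfact (int n + 2 * int s) :: 'a fps)" for n k
  have beta: "qpoch fps_X (fps_X ^ 2) n * qpoch fps_X fps_X n * slater_beta n = (1 :: 'a fps)" for n
    unfolding slater_beta_def by (rule mult_recip) (simp add: fps_nth_qpoch_0)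
  have stable: "S n k = S n n" if "k \<ge> n" for n k
    unfolding S_def by (rule sum.mono_neutral_right) (use that in auto)
  have "S n n = slater_beta n"
  proof (induction n)
    case 0
    then show ?case using beta[of 0] by (simp add: S_def)
  next
    case (Suc n)
    define D where "D = (1 - fps_X ^ Suc n) * (1 - fps_X ^ (2 * n + 1) :: 'a fps)"
    have "D * S (Suc n) (Suc n) - S n (Suc n) = 0"
      using slater_partial_sum[of n "Suc n", where 'a = 'a] unfolding S_def D_def by simp
    then have "D * S (Suc n) (Suc n) = slater_beta n" using stable[of n "Suc n"] Suc by simp
    also have "(slater_beta n :: 'a fps) = slater_beta n * (qpoch fps_X (fps_X ^ 2) (Suc n) * qpoch fps_X fps_X (Suc n) * slater_beta (Suc n))"
      by (simp only: beta) simp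
    also have "\<dots> = (qpoch fps_X (fps_X ^ 2) n * qpoch fps_X fps_X n * slater_beta n) * (D * slater_beta (Suc n))"
      unfolding qpoch_Suc D_def by (simp add: power_mult[symmetric] mult_ac)
    finally have "D * S (Suc n) (Suc n) = D * slater_beta (Suc n)" by (simp only: beta mult_1)
    moreover have "D \<noteq> 0" unfolding D_def using one_minus_nonzero[of "Suc n"] one_minus_nonzero[of "2*n+1"] by simp
    ultimately show ?case by simp
  qed
  then show ?thesis unfolding S_def .
qed

text \<open>
  The difference of the two \<open>\<alpha>\<close>-sequences, divided by their common factor \<open>1 + q\<^sup>r\<close> (for \<open>r \<ge> 1\<close>).
\<close>
definition crank_rank_alpha :: "nat \<Rightarrow> 'a::idom fps" where
  "crank_rank_alpha r = (if even r then (-1) ^ (r div 2) * fps_X ^ (r div 2 * (3 * (r div 2) - 1)) else 0)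
             - (-1) ^ r * fps_X ^ (r * (r - 1) div 2)"

lemma sum_over_even:
  fixes F :: "nat \<Rightarrow> 'a::comm_monoid_add"
  assumes "\<And>s. N < 2 * s \<Longrightarrow> F s = 0"
  shows "(\<Sum>r=1..N. if even r then F (r div 2) else 0) = (\<Sum>s=1..N. F s)"
proof -
  have "(\<Sum>r=1..N. if even r then F (r div 2) else 0) = (\<Sum>r | r \<in> {1..N} \<and> even r. F (r div 2))"
    by (rule sum.inter_filter[symmetric]) simp
  also have "\<dots> = (\<Sum>s | s \<in> {1..N} \<and> 2 * s \<le> N. F s)"
    by (rule sum.reindex_bij_witness[of _ "\<lambda>s. 2 * s" "\<lambda>r. r div 2"]) auto
  also have "\<dots> = (\<Sum>s=1..N. F s)"
  proof (rule sum.mono_neutral_left)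
    show "\<forall>s\<in>{1..N} - {s \<in> {1..N}. 2 * s \<le> N}. F s = 0" using assms not_le by blast
  qed auto
  finally show ?thesis .
qed

text \<open>
  Both pairs have \<open>\<alpha>\<^sub>0 = 1\<close>, so subtracting the unit pair removes the term with \<open>r = 0\<close>.
\<close>
lemma slater_beta_expansion:
  assumes "1 \<le> n" "n \<le> N"
  shows "slater_beta n = (\<Sum>r=1..N. (1 + fps_X ^ r) * crank_rank_alpha r * recip_qfact (int n - int r) * recip_qfact (int n + int r) :: 'a::idom fps)"
proof -
  define w where "w r = (recip_qfact (int n - int r) * recip_qfact (int n + int r) :: 'a fps)" for r
  have w0: "w r = 0" if "r > n" for r using that by (simp add: w_def)
  have split0: "(\<Sum>r\<le>n. f r) = f 0 + (\<Sum>r=1..n. f r)" for f :: "nat \<Rightarrow> 'a fps"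
    by (simp add: sum.atMost_shift sum.atLeast1_atMost_eq)
  have "slater_beta n = (\<Sum>s\<le>n. slater_alpha s * w (2 * s))"
    unfolding slater_pair[symmetric] w_def by (simp add: mult_ac)
  also have "\<dots> = w 0 + (\<Sum>s=1..n. slater_alpha s * w (2 * s))" unfolding split0 by simp
  also have "(\<Sum>s=1..n. slater_alpha s * w (2 * s)) = (\<Sum>r=1..n. if even r then slater_alpha (r div 2) * w (2 * (r div 2)) else 0)"
    by (rule sum_over_even[symmetric]) (simp add: w0)
  finally have b: "slater_beta n = w 0 + \<dots>" .
  have "(\<Sum>r\<le>n. unit_alpha r * w r) = 0"
    using unit_pair[OF assms(1), where 'a = 'a] by (simp add: w_def mult_ac)
  then have "w 0 = - (\<Sum>r=1..n. unit_alpha r * w r)"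
    unfolding split0 by (simp add: unit_alpha_def eq_neg_iff_add_eq_0)
  then have "slater_beta n = (\<Sum>r=1..n. (if even r then slater_alpha (r div 2) * w (2 * (r div 2)) else 0) - unit_alpha r * w r)"
    unfolding b sum_subtractf by simp
  also have "\<dots> = (\<Sum>r=1..n. (1 + fps_X ^ r) * crank_rank_alpha r * w r)"
  proof (rule sum.cong[OF refl])
    fix r assume r: "r \<in> {1..n}"
    then have u: "unit_alpha r = (-1) ^ r * fps_X ^ (r * (r - 1) div 2) * (1 + fps_X ^ r :: 'a fps)"
      by (simp add: unit_alpha_def)
    show "(if even r then slater_alpha (r div 2) * w (2 * (r div 2)) else 0) - unit_alpha r * w r = (1 + fps_X ^ r) * crank_rank_alpha r * w r"
    proof (cases "even r")
      case True
      with r have "r div 2 \<noteq> 0" "2 * (r div 2) = r" by auto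
      then show ?thesis unfolding u crank_rank_alpha_def slater_alpha_def using True by (simp add: algebra_simps)
    next
      case False
      then show ?thesis unfolding u crank_rank_alpha_def by (simp add: algebra_simps)
    qed
  qed
  also have "\<dots> = (\<Sum>r=1..N. (1 + fps_X ^ r) * crank_rank_alpha r * w r)"
    by (rule sum.mono_neutral_left) (use assms w0 in auto)
  finally show ?thesis by (simp add: w_def mult_ac)
qed

section \<open>Summation over n\<close>

definition two_sided_geom :: "nat \<Rightarrow> laurent_poly fps" where
  "two_sided_geom r = recip ((1 - z_pow 1 * qX ^ r) * (1 - z_pow (-1) * qX ^ r))"

lemma two_sided_geom_mult: "r \<ge> 1 \<Longrightarrow> ((1 - z_pow 1 * qX ^ r) * (1 - z_pow (-1) * qX ^ r)) * two_sided_geom r = 1"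
  unfolding two_sided_geom_def by (rule mult_recip) simp

lemma z_inverse: "z_pow 1 * z_pow (-1) = 1"
  by (simp add: mult_single flip: single_one)

text \<open>
  A \<open>q\<close>-Gauss sum with argument \<open>q\<close>. In that case already the partial sums have a closed form, because
  \<open>(1 - z q\<^sup>n)(1 - q\<^sup>n/z) - (1 - q\<^bsup>n-r\<^esup>)(1 - q\<^bsup>n+r\<^esup>) = q\<^bsup>n-r\<^esup> (1 - z q\<^sup>r)(1 - q\<^sup>r/z)\<close>.
\<close>
lemma recip_tails_telescope:
  assumes "1 \<le> r" "r \<le> N"
  shows "(\<Sum>n=1..N. qX ^ n * recip_tails n * recip_qfact (int n - int r) * recip_qfact (int n + int r)) =
           qX ^ r * recip_tails (Suc N) * two_sided_geom r * recip_qfact (int N - int r) * recip_qfact (int N + int r)"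
  using assms(2)
proof (induction N rule: dec_induct)
  case base
  have "recip_tails r = recip_tails r * (((1 - z_pow 1 * qX ^ r) * (1 - z_pow (-1) * qX ^ r)) * two_sided_geom r)"
    by (simp only: two_sided_geom_mult[OF assms(1)] mult_1_right)
  also have "\<dots> = recip_tails (Suc r) * two_sided_geom r" using recip_tails_step[OF assms(1)] by (simp only: mult.assoc[symmetric])
  finally have recip_tails: "recip_tails r = recip_tails (Suc r) * two_sided_geom r" .
  have "{1..r} = insert r {1..<r}" using assms by auto
  then have "(\<Sum>n=1..r. qX ^ n * recip_tails n * recip_qfact (int n - int r) * recip_qfact (int n + int r)) = qX ^ r * recip_tails r * recip_qfact (int r + int r)"
    by simp
  then show ?case unfolding recip_tails by (simp add: mult_ac)
next
  case (step N)
  define z zi where "z = z_pow 1" and "zi = z_pow (-1)"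
  have zz: "z * zi = 1" unfolding z_def zi_def by (rule z_inverse)
  define t where "t = Suc N - r"
  have n: "Suc N = r + t" using step by (simp add: t_def)
  define p w :: "laurent_poly fps" where "p = recip_qfact (int t)" and "w = recip_qfact (int (Suc N + r))"
  have "int N - int r = int t - 1" "int N + int r = int (Suc N + r) - 1"
     "int (Suc N) - int r = int t" "int (Suc N) + int r = int (Suc N + r)" using n by simp_all
  then have i: "recip_qfact (int N - int r) = (1 - qX ^ t) * p" "recip_qfact (int N + int r) = (1 - qX ^ (Suc N + r)) * w"
     "recip_qfact (int (Suc N) - int r) = p" "recip_qfact (int (Suc N) + int r) = w"
    by (simp_all only: p_def w_def recip_qfact_pred)
  define x y where "x = qX ^ r" and "y = qX ^ t"
  have pow: "qX ^ Suc N = x * y" "qX ^ (Suc N + r) = x * y * x" unfolding x_def y_def n power_add by simp_all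
  have G: "((1 - z * x) * (1 - zi * x)) * two_sided_geom r = 1" using two_sided_geom_mult[OF assms(1)] unfolding z_def zi_def x_def .
  have recip_tails: "recip_tails (Suc (Suc N)) = recip_tails (Suc N) * ((1 - z * (x * y)) * (1 - zi * (x * y)))"
    using recip_tails_step[of "Suc N"] unfolding z_def zi_def pow by simp
  have S: "(\<Sum>n=1..Suc N. f n) = (\<Sum>n=1..N. f n) + f (Suc N)" for f :: "nat \<Rightarrow> laurent_poly fps" by simp
  have "(\<Sum>n=1..Suc N. qX ^ n * recip_tails n * recip_qfact (int n - int r) * recip_qfact (int n + int r)) =
      x * recip_tails (Suc N) * two_sided_geom r * ((1 - y) * p) * ((1 - x * y * x) * w) + x * y * recip_tails (Suc N) * p * w * (((1 - z * x) * (1 - zi * x)) * two_sided_geom r)"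
    unfolding S step.IH i pow G x_def[symmetric] y_def[symmetric] by (simp only: mult_1_right)
  also have "\<dots> = x * (recip_tails (Suc N) * ((1 - z * (x * y)) * (1 - zi * (x * y)))) * two_sided_geom r * p * w"
    using zz by algebra
  also have "\<dots> = qX ^ r * recip_tails (Suc (Suc N)) * two_sided_geom r * recip_qfact (int (Suc N) - int r) * recip_qfact (int (Suc N) + int r)"
    unfolding recip_tails i x_def by (simp only: mult_ac)
  finally show ?case .
qed

lemma C1_term_sum:
  "(\<Sum>n=1..N. C1_term n) =
     (\<Sum>r=1..N. (1 + qX ^ r) * crank_rank_alpha r * (qX ^ r * recip_tails (Suc N) * two_sided_geom r * recip_qfact (int N - int r) * recip_qfact (int N + int r)))"
proof -
  have "(\<Sum>n=1..N. C1_term n) = (\<Sum>n=1..N. qX ^ n * recip_tails n * slater_beta n)"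
    by (simp add: C1_term_def recip_tails_def slater_beta_def)
  also have "\<dots> = (\<Sum>n=1..N. \<Sum>r=1..N. qX ^ n * recip_tails n * ((1 + qX ^ r) * crank_rank_alpha r * recip_qfact (int n - int r) * recip_qfact (int n + int r)))"
  proof (rule sum.cong[OF refl])
    fix n assume "n \<in> {1..N}"
    then show "qX ^ n * recip_tails n * slater_beta n =
       (\<Sum>r=1..N. qX ^ n * recip_tails n * ((1 + qX ^ r) * crank_rank_alpha r * recip_qfact (int n - int r) * recip_qfact (int n + int r)))"
      unfolding sum_distrib_left[symmetric] by (subst slater_beta_expansion[of n N]) auto
  qed
  also have "\<dots> = (\<Sum>r=1..N. \<Sum>n=1..N. qX ^ n * recip_tails n * ((1 + qX ^ r) * crank_rank_alpha r * recip_qfact (int n - int r) * recip_qfact (int n + int r)))"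
    by (rule sum.swap)
  also have "\<dots> = (\<Sum>r=1..N. (1 + qX ^ r) * crank_rank_alpha r * (\<Sum>n=1..N. qX ^ n * recip_tails n * recip_qfact (int n - int r) * recip_qfact (int n + int r)))"
    unfolding sum_distrib_left by (intro sum.cong refl) (simp only: mult_ac)
  also have "\<dots> = (\<Sum>r=1..N. (1 + qX ^ r) * crank_rank_alpha r * (qX ^ r * recip_tails (Suc N) * two_sided_geom r * recip_qfact (int N - int r) * recip_qfact (int N + int r)))"
    by (intro sum.cong refl, subst recip_tails_telescope) auto
  finally show ?thesis .
qed

lemma suminf_agree:
  fixes f :: "nat \<Rightarrow> 'a::comm_ring_1 fps"
  assumes "summable f" "\<And>i. agree_upto i (f i) 0"
  shows "agree_upto N (suminf f) (\<Sum>i<N. f i)"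
  unfolding agree_upto_def
proof (intro allI impI)
  fix j assume j: "j \<le> N"
  have "(\<lambda>k. \<Sum>i<k. f i) \<longlonglongrightarrow> suminf f" using assms(1) by (rule summable_LIMSEQ)
  then have "\<forall>\<^sub>F k in sequentially. fps_nth (\<Sum>i<k. f i) j = fps_nth (suminf f) j"
    unfolding tendsto_fps_iff by blast
  then have "\<forall>\<^sub>F k in sequentially. fps_nth (\<Sum>i<N. f i) j = fps_nth (suminf f) j"
    using eventually_ge_at_top[of N]
  proof eventually_elim
    case (elim k)
    have "fps_nth (\<Sum>i<k. f i) j = fps_nth (\<Sum>i<N. f i) j"
      unfolding fps_sum_nth using assms(2) elim(2) j
      by (intro sum.mono_neutral_right) (auto simp: agree_upto_def)
    then show ?case using elim(1) by simp
  qed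
  then show "fps_nth (suminf f) j = fps_nth (\<Sum>i<N. f i) j" by simp
qed

definition const_in_z :: "int fps \<Rightarrow> laurent_poly fps" where
  "const_in_z a = Abs_fps (\<lambda>n. Poly_Mapping.single 0 (fps_nth a n))"

lemma single_0_sum: "Poly_Mapping.single 0 (sum f A) = (\<Sum>x\<in>A. Poly_Mapping.single (0::int) (f x :: int))"
  by (induction A rule: infinite_finite_induct) (simp_all add: single_add)

lemma const_in_z_mult: "const_in_z (a * b) = const_in_z a * const_in_z b"
  by (rule fps_ext) (simp add: const_in_z_def fps_mult_nth single_0_sum mult_single)
lemma const_in_z_1 [simp]: "const_in_z 1 = 1"
  by (rule fps_ext) (simp add: const_in_z_def)
lemma const_in_z_X [simp]: "const_in_z fps_X = qX"
  by (rule fps_ext) (simp add: const_in_z_def fps_X_def)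
lemma const_in_z_add: "const_in_z (a + b) = const_in_z a + const_in_z b"
  by (rule fps_ext) (simp add: const_in_z_def single_add)
lemma const_in_z_0 [simp]: "const_in_z 0 = 0"
  by (rule fps_ext) (simp add: const_in_z_def)
lemma const_in_z_uminus: "const_in_z (- a) = - const_in_z a"
  by (rule fps_ext) (simp add: const_in_z_def single_uminus)
lemma const_in_z_diff: "const_in_z (a - b) = const_in_z a - const_in_z b"
  using const_in_z_add[of a "- b"] by (simp add: const_in_z_uminus)
lemma const_in_z_power: "const_in_z (a ^ n) = const_in_z a ^ n"
  by (induction n) (simp_all add: const_in_z_mult)

lemma const_in_z_crank_rank_alpha: "const_in_z (crank_rank_alpha r) = crank_rank_alpha r"
  unfolding crank_rank_alpha_def by (simp add: const_in_z_diff const_in_z_mult const_in_z_power const_in_z_uminus)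

text \<open>
  Equals \<open>1/(q\<^sup>2;q\<^sup>2)\<^sub>N\<close>.
\<close>
definition even_partition_gf :: "nat \<Rightarrow> int fps" where
  "even_partition_gf N = Abs_fps (\<lambda>n. if even n then bounded_partitions N (n div 2) else 0)"

lemma even_partition_gf_mult: "even_partition_gf N * qpoch (fps_X ^ 2) (fps_X ^ 2) N = 1"
proof (induction N)
  case 0
  show ?case by (rule fps_ext) (auto simp: even_partition_gf_def elim!: evenE)
next
  case (Suc N)
  have "even_partition_gf (Suc N) * (1 - fps_X ^ (2 * Suc N)) = even_partition_gf N"
  proof (rule fps_ext)
    fix n
    show "fps_nth (even_partition_gf (Suc N) * (1 - fps_X ^ (2 * Suc N))) n = fps_nth (even_partition_gf N) n"
    proof (cases "even n")
      case True
      then obtain k where n: "n = 2 * k" by (auto elim: evenE)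
      have e: "2 * k - 2 * Suc N = 2 * (k - Suc N)" by simp
      show ?thesis
        unfolding even_partition_gf_def right_diff_distrib fps_sub_nth mult_1_right fps_X_power_mult_right_nth fps_nth_Abs_fps n e
        using bounded_partitions_Suc[of N k] by (auto split: if_splits)
    next
      case False
      then show ?thesis
        unfolding even_partition_gf_def right_diff_distrib fps_sub_nth mult_1_right fps_X_power_mult_right_nth fps_nth_Abs_fps
        by auto
    qed
  qed
  moreover have "(fps_X ^ 2) * (fps_X ^ 2) ^ N = (fps_X :: int fps) ^ (2 * Suc N)"
    unfolding power_mult[symmetric] power_add[symmetric]
    by (rule arg_cong[where f = "\<lambda>i. fps_X ^ i"]) simp
  moreover have "even_partition_gf (Suc N) * qpoch (fps_X ^ 2) (fps_X ^ 2) (Suc N) =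
     (even_partition_gf (Suc N) * (1 - (fps_X ^ 2) * (fps_X ^ 2) ^ N)) * qpoch (fps_X ^ 2) (fps_X ^ 2) N"
    by (simp only: qpoch_Suc mult_ac)
  ultimately show ?case using Suc by (simp only:)
qed

lemma const_in_z_qpoch: "const_in_z (qpoch a b n) = qpoch (const_in_z a) (const_in_z b) n"
  by (induction n) (simp_all add: qpoch_Suc const_in_z_mult const_in_z_diff const_in_z_power)

lemma qpoch_X_even:
  "qpoch fps_X fps_X (2 * n) = (qpoch fps_X (fps_X ^ 2) n * qpoch (fps_X ^ 2) (fps_X ^ 2) n :: 'a::comm_ring_1 fps)"
proof (induction n)
  case (Suc n)
  have "2 * Suc n = Suc (Suc (2 * n))" by simp
  moreover have "fps_X * (fps_X ^ 2) ^ n = (fps_X * fps_X ^ (2 * n) :: 'a fps)"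
    "fps_X ^ 2 * (fps_X ^ 2) ^ n = (fps_X * fps_X ^ Suc (2 * n) :: 'a fps)"
    by (simp_all only: power_mult[symmetric] power_add[symmetric] power_Suc[symmetric] add_2_eq_Suc)
  ultimately show ?case using Suc by (simp only: qpoch_Suc mult_ac)
qed simp

lemma const_in_z_even_partition_gf: "const_in_z (even_partition_gf N) = qpoch qX (qX ^ 2) N * recip_qfact (int (2 * N))"
proof -
  have e: "const_in_z (even_partition_gf N) * qpoch (qX ^ 2) (qX ^ 2) N = 1"
    using even_partition_gf_mult[of N, THEN arg_cong, of const_in_z] by (simp add: const_in_z_mult const_in_z_qpoch const_in_z_power)
  have "const_in_z (even_partition_gf N) = const_in_z (even_partition_gf N) * (qpoch qX qX (2 * N) * recip_qfact (int (2 * N)))" by (simp only: recip_qfact_mult mult_1_right)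
  also have "\<dots> = (const_in_z (even_partition_gf N) * qpoch (qX ^ 2) (qX ^ 2) N) * (qpoch qX (qX ^ 2) N * recip_qfact (int (2 * N)))"
    unfolding qpoch_X_even by (simp only: mult_ac)
  finally show ?thesis by (simp only: e mult_1)
qed

lemma recip_qfact_agree:
  assumes "N \<le> k" "N \<le> l"
  shows "agree_upto N (recip_qfact (int k)) (recip_qfact (int l) :: 'a::idom fps)"
proof -
  have "agree_upto N (qpoch fps_X fps_X k) (qpoch_inf fps_X fps_X :: 'a fps)" if "N \<le> k" for k
    by (rule agree_upto_sym, rule qpoch_inf_agree) (use that in auto)
  then have "agree_upto N (qpoch fps_X fps_X k) (qpoch fps_X fps_X l :: 'a fps)"
    using assms by (blast intro: agree_upto_trans agree_upto_sym)
  then show ?thesis unfolding recip_qfact_def by (auto intro!: agree_upto_recip simp: fps_nth_qpoch_0)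
qed

text \<open>
  Modulo \<open>q\<^bsup>N+1\<^esup>\<close> the factor \<open>recip_tails (N + 1)\<close> left by the telescoping is 1, the two reciprocals
  become \<open>1/(q)\<^sub>\<infinity>\<close>, and \<open>(q;q\<^sup>2)\<^sub>\<infinity> (q)\<^sub>\<infinity> / (q)\<^sub>\<infinity>\<^sup>2 = 1/(q\<^sup>2;q\<^sup>2)\<^sub>\<infinity>\<close>. The congruence
  \<open>1/(q)\<^bsub>N-r\<^esub> \<equiv> 1/(q)\<^sub>\<infinity>\<close> only holds modulo \<open>q\<^bsup>N-r+1\<^esup>\<close>, which the factor \<open>q\<^sup>r\<close> makes up for.
\<close>
lemma C1_gf_agree: "agree_upto N C1_gf (const_in_z (even_partition_gf N) * (\<Sum>r=1..N. (1 + qX ^ r) * crank_rank_alpha r * (qX ^ r * two_sided_geom r)))"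
proof -
  let ?I1 = "qpoch_inf qX (qX ^ 2)" and ?I2 = "qpoch_inf qX qX"
  have "agree_upto i (C1_term (Suc i)) 0" for i
    unfolding C1_term_def mult.assoc by (subst mult.commute) (intro agree_upto_X_power_0, simp)
  then have "agree_upto N (suminf (\<lambda>n. C1_term (Suc n))) (\<Sum>i<N. C1_term (Suc i))"
    by (intro suminf_agree summable_C1_term)
  moreover have "(\<Sum>i<N. C1_term (Suc i)) = (\<Sum>n=1..N. C1_term n)"
    by (rule sum.reindex_bij_witness[of _ "\<lambda>n. n - 1" Suc]) auto
  ultimately have "agree_upto N C1_gf (?I1 * ?I2 * (\<Sum>n=1..N. C1_term n))"
    unfolding C1_gf_def by (intro agree_upto_mult agree_upto_refl) simp
  also have "agree_upto N \<dots> (?I1 * ?I2 * (\<Sum>r=1..N. (1 + qX ^ r) * crank_rank_alpha r * (qX ^ r * 1 * two_sided_geom r * recip_qfact (int N) * recip_qfact (int (2 * N)))))"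
    unfolding C1_term_sum
  proof (rule agree_upto_mult[OF agree_upto_refl], rule agree_upto_sum, rule agree_upto_mult[OF agree_upto_refl])
    fix r assume r: "r \<in> {1..N}"
    have a: "agree_upto N (qX ^ r * recip_qfact (int (N - r))) (qX ^ r * recip_qfact (int N))"
      using r by (intro agree_upto_X_power recip_qfact_agree) auto
    have b: "agree_upto N (recip_qfact (int (N + r))) (recip_qfact (int (2 * N)))" by (intro recip_qfact_agree) auto
    have "agree_upto N ((qX ^ r * recip_qfact (int (N - r))) * (recip_tails (Suc N) * two_sided_geom r * recip_qfact (int (N + r))))
             ((qX ^ r * recip_qfact (int N)) * (1 * two_sided_geom r * recip_qfact (int (2 * N))))"
      by (intro agree_upto_mult agree_upto_refl a b recip_tails_agree)
    moreover have "int N - int r = int (N - r)" "int N + int r = int (N + r)" using r by auto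
    ultimately show "agree_upto N (qX ^ r * recip_tails (Suc N) * two_sided_geom r * recip_qfact (int N - int r) * recip_qfact (int N + int r))
        (qX ^ r * 1 * two_sided_geom r * recip_qfact (int N) * recip_qfact (int (2 * N)))" by (simp only: mult_ac)
  qed
  also have "?I1 * ?I2 * (\<Sum>r=1..N. (1 + qX ^ r) * crank_rank_alpha r * (qX ^ r * 1 * two_sided_geom r * recip_qfact (int N) * recip_qfact (int (2 * N))))
     = ?I1 * recip_qfact (int (2 * N)) * (?I2 * recip_qfact (int N)) * (\<Sum>r=1..N. (1 + qX ^ r) * crank_rank_alpha r * (qX ^ r * two_sided_geom r))"
    unfolding sum_distrib_left by (intro sum.cong refl) (simp only: mult_ac mult_1)
  also have "agree_upto N \<dots> (qpoch qX (qX ^ 2) N * recip_qfact (int (2 * N)) * (qpoch qX qX N * recip_qfact (int N)) * (\<Sum>r=1..N. (1 + qX ^ r) * crank_rank_alpha r * (qX ^ r * two_sided_geom r)))"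
    by (intro agree_upto_mult agree_upto_refl qpoch_inf_agree) auto
  also have "\<dots> = const_in_z (even_partition_gf N) * (\<Sum>r=1..N. (1 + qX ^ r) * crank_rank_alpha r * (qX ^ r * two_sided_geom r))"
    unfolding const_in_z_even_partition_gf recip_qfact_mult by (simp only: mult_1_right)
  finally show ?thesis .
qed

section \<open>Coefficients of powers of z\<close>

definition zcoeff :: "int \<Rightarrow> laurent_poly fps \<Rightarrow> int fps" where
  "zcoeff k f = Abs_fps (\<lambda>n. Poly_Mapping.lookup (fps_nth f n) k)"

lemma lookup_single_mult: "Poly_Mapping.lookup (Poly_Mapping.single j c * p) k = c * Poly_Mapping.lookup p (k - j)"
  for j :: int and c :: int
proof -
  have "Sum_any (\<lambda>q. (Poly_Mapping.lookup p q when k = l + q)) = Poly_Mapping.lookup p (k - l)" for l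
  proof -
    have "(\<lambda>q. (Poly_Mapping.lookup p q when k = l + q)) = (\<lambda>q. (Poly_Mapping.lookup p q when q = k - l))"
      by (auto simp: when_def fun_eq_iff)
    then show ?thesis by (simp only: Sum_any_when_equal)
  qed
  then show ?thesis unfolding lookup_mult lookup_single by (simp add: when_mult)
qed

lemma zcoeff_add: "zcoeff k (f + g) = zcoeff k f + zcoeff k g"
  by (rule fps_ext) (simp add: zcoeff_def lookup_add)
lemma zcoeff_diff: "zcoeff k (f - g) = zcoeff k f - zcoeff k g"
  by (rule fps_ext) (simp add: zcoeff_def lookup_minus)
lemma lookup_sum_poly_mapping: "Poly_Mapping.lookup (sum f A) k = (\<Sum>x\<in>A. Poly_Mapping.lookup (f x) k)"
  by (induction A rule: infinite_finite_induct) (simp_all add: lookup_add)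
lemma zcoeff_sum: "zcoeff k (sum f A) = (\<Sum>x\<in>A. zcoeff k (f x))"
  by (rule fps_ext) (simp add: zcoeff_def fps_sum_nth lookup_sum_poly_mapping)
lemma zcoeff_const_in_z_mult: "zcoeff k (const_in_z a * f) = a * zcoeff k f"
  by (rule fps_ext) (simp add: zcoeff_def const_in_z_def fps_mult_nth lookup_sum_poly_mapping lookup_single_mult)
lemma zcoeff_z_pow_mult: "zcoeff k (z_pow j * f) = zcoeff (k - j) f"
  by (rule fps_ext) (simp add: zcoeff_def lookup_single_mult)
lemma zcoeff_1: "zcoeff k 1 = (if k = 0 then 1 else 0)"
  by (rule fps_ext) (simp add: zcoeff_def lookup_one when_def)

text \<open>
  Such a series is divisible by every power of \<open>q\<close>.
\<close>
lemma geometric_descent_zero: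
  fixes w :: "nat \<Rightarrow> int fps"
  assumes "r \<ge> 1" "\<And>k. w k = fps_X ^ r * w (Suc k)"
  shows "w 0 = 0"
proof (rule fps_ext)
  fix n
  have "w 0 = fps_X ^ (r * j) * w j" for j
  proof (induction j)
    case (Suc j)
    then show ?case by (subst (asm) assms(2)) (simp add: power_add mult_ac)
  qed simp
  then have "fps_nth (w 0) n = fps_nth (fps_X ^ (r * Suc n) * w (Suc n)) n" by metis
  moreover have "Suc n \<le> r * Suc n" using mult_le_mono1[OF assms(1), of "Suc n"] by (simp only: mult_1)
  then have "n < r * Suc n" by (rule Suc_le_lessD)
  ultimately show "fps_nth (w 0) n = fps_nth 0 n"
    by (simp only: fps_X_power_mult_nth if_True fps_zero_nth)
qed

text \<open>
  The coefficients \<open>x\<^sub>k\<close> of the fraction satisfy a three-term recurrence, which factors: \<open>x\<^sub>k - q\<^sup>r x\<^bsub>k-1\<^esub>\<close> is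
  \<open>q\<^sup>r\<close> times its successor when \<open>k \<ge> 1\<close>, hence zero, and symmetrically for \<open>k \<le> -1\<close>. So
  \<open>x\<^sub>k = q\<^bsup>r\<bar>k\<bar>\<^esup> x\<^sub>0\<close>, and the recurrence at 0 gives \<open>(1 - q\<^bsup>2r\<^esup>) x\<^sub>0 = 1\<close>.
\<close>
lemma zcoeff_two_sided_geom:
  assumes r: "r \<ge> 1"
  shows "(1 + fps_X ^ r) * (zcoeff (int m) (two_sided_geom r) - zcoeff (int m + 1) (two_sided_geom r)) = fps_X ^ (r * m)"
proof -
  define x where "x k = zcoeff k (two_sided_geom r)" for k
  define y where "y = (fps_X :: int fps) ^ r"
  have y: "qX ^ r = const_in_z y" unfolding y_def by (simp add: const_in_z_power)
  have "((1 - z_pow 1 * qX ^ r) * (1 - z_pow (-1) * qX ^ r)) * two_sided_geom r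
     = two_sided_geom r + qX ^ r * (qX ^ r * two_sided_geom r) * (z_pow 1 * z_pow (-1)) - qX ^ r * (z_pow 1 * two_sided_geom r) - qX ^ r * (z_pow (-1) * two_sided_geom r)"
    by (simp only: left_diff_distrib right_diff_distrib) (simp add: algebra_simps)
  then have "1 = two_sided_geom r + qX ^ r * (qX ^ r * two_sided_geom r) - qX ^ r * (z_pow 1 * two_sided_geom r) - qX ^ r * (z_pow (-1) * two_sided_geom r)"
    unfolding two_sided_geom_mult[OF r] z_inverse by simp
  then have "zcoeff k 1 = zcoeff k (two_sided_geom r + qX ^ r * (qX ^ r * two_sided_geom r) - qX ^ r * (z_pow 1 * two_sided_geom r) - qX ^ r * (z_pow (-1) * two_sided_geom r))" for k
    by simp
  then have rec: "(if k = 0 then 1 else 0) = x k + y * (y * x k) - y * x (k - 1) - y * x (k + 1)" for k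
    unfolding y zcoeff_1 zcoeff_diff zcoeff_add zcoeff_const_in_z_mult zcoeff_z_pow_mult x_def by simp
  have up: "x k = y * x (k - 1)" if "k \<ge> 1" for k
  proof -
    define w where "w j = x (k + int j) - y * x (k + int j - 1)" for j
    have "w 0 = 0"
    proof (rule geometric_descent_zero[OF r])
      fix j
      show "w j = fps_X ^ r * w (Suc j)"
        using rec[of "k + int j"] that unfolding w_def y_def[symmetric] by (simp add: algebra_simps)
    qed
    then show ?thesis by (simp add: w_def)
  qed
  have down: "x k = y * x (k + 1)" if "k \<le> -1" for k
  proof -
    define w where "w j = x (k - int j) - y * x (k - int j + 1)" for j
    have "w 0 = 0"
    proof (rule geometric_descent_zero[OF r])
      fix j
      show "w j = fps_X ^ r * w (Suc j)"
        using rec[of "k - int j"] that unfolding w_def y_def[symmetric] by (simp add: algebra_simps)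
    qed
    then show ?thesis by (simp add: w_def)
  qed
  have x0: "(1 - y * y) * x 0 = 1"
    using rec[of 0] up[of 1] down[of "-1"] by (simp add: algebra_simps)
  have xm: "x (int m) = y ^ m * x 0" for m
    by (induction m) (simp_all add: up mult.assoc)
  have "(1 + y) * (x (int m) - x (int m + 1)) = y ^ m * ((1 - y * y) * x 0)"
    using xm[of m] xm[of "Suc m"] by (simp add: algebra_simps)
  then show ?thesis unfolding x0 by (simp add: x_def y_def power_mult)
qed

lemma N_C1_diff_eq_coeff:
  "N_C1 (int m) n - N_C1 (int m + 1) n =
     fps_nth (even_partition_gf n * (\<Sum>r=1..n. crank_rank_alpha r * fps_X ^ (r * (m + 1)))) n"
proof -
  let ?F = "\<Sum>r=1..n. (1 + qX ^ r) * crank_rank_alpha r * (qX ^ r * two_sided_geom r)"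
  have z: "zcoeff k ?F = (\<Sum>r=1..n. (1 + fps_X ^ r) * crank_rank_alpha r * fps_X ^ r * zcoeff k (two_sided_geom r))" for k
    unfolding zcoeff_sum
  proof (rule sum.cong[OF refl])
    fix r
    have "(1 + qX ^ r) * crank_rank_alpha r * (qX ^ r * two_sided_geom r) = const_in_z ((1 + fps_X ^ r) * crank_rank_alpha r * fps_X ^ r) * two_sided_geom r"
      by (simp add: const_in_z_mult const_in_z_add const_in_z_power const_in_z_crank_rank_alpha mult.assoc)
    then show "zcoeff k ((1 + qX ^ r) * crank_rank_alpha r * (qX ^ r * two_sided_geom r)) = (1 + fps_X ^ r) * crank_rank_alpha r * fps_X ^ r * zcoeff k (two_sided_geom r)"
      by (simp only: zcoeff_const_in_z_mult)
  qed
  have N: "N_C1 k n = fps_nth (even_partition_gf n * zcoeff k ?F) n" for k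
  proof -
    have "N_C1 k n = fps_nth (zcoeff k (const_in_z (even_partition_gf n) * ?F)) n"
      using C1_gf_agree[of n] by (simp add: N_C1_def zcoeff_def agree_upto_def)
    then show ?thesis by (simp only: zcoeff_const_in_z_mult)
  qed
  have "N_C1 (int m) n - N_C1 (int m + 1) n = fps_nth (even_partition_gf n * (zcoeff (int m) ?F - zcoeff (int m + 1) ?F)) n"
    unfolding N by (simp only: fps_sub_nth[symmetric] right_diff_distrib)
  also have "zcoeff (int m) ?F - zcoeff (int m + 1) ?F = (\<Sum>r=1..n. crank_rank_alpha r * fps_X ^ (r * (m + 1)))"
    unfolding z sum_subtractf[symmetric]
  proof (rule sum.cong[OF refl])
    fix r assume "r \<in> {1..n}"
    then have "r \<ge> 1" by simp
    have "(1 + fps_X ^ r) * crank_rank_alpha r * fps_X ^ r * zcoeff (int m) (two_sided_geom r) - (1 + fps_X ^ r) * crank_rank_alpha r * fps_X ^ r * zcoeff (int m + 1) (two_sided_geom r)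
      = crank_rank_alpha r * fps_X ^ r * ((1 + fps_X ^ r) * (zcoeff (int m) (two_sided_geom r) - zcoeff (int m + 1) (two_sided_geom r)))"
      by (simp only: right_diff_distrib mult_ac)
    also have "\<dots> = crank_rank_alpha r * fps_X ^ (r * (m + 1))"
      unfolding zcoeff_two_sided_geom[OF \<open>r \<ge> 1\<close>] by (simp add: power_add mult.assoc)
    finally show "(1 + fps_X ^ r) * crank_rank_alpha r * fps_X ^ r * zcoeff (int m) (two_sided_geom r) - (1 + fps_X ^ r) * crank_rank_alpha r * fps_X ^ r * zcoeff (int m + 1) (two_sided_geom r)
      = crank_rank_alpha r * fps_X ^ (r * (m + 1))" .
  qed
  finally show ?thesis .
qed

lemma even_partition_gf_mult_X_power_nth: "fps_nth (even_partition_gf n * fps_X ^ k) n = partitions_of_half (int n - int k)"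
proof (cases "k \<le> n")
  case True
  then have "int n - int k = int (n - k)" by simp
  moreover have "nat (int (n - k) div 2) = (n - k) div 2" using nat_div_distrib[of "int (n - k)" 2] by simp
  ultimately show ?thesis using True
    unfolding fps_X_power_mult_right_nth partitions_of_half_def partitions_of_int_def even_partition_gf_def
    by (auto simp: bounded_partitions_eq_partitions)
next
  case False
  then show ?thesis unfolding fps_X_power_mult_right_nth partitions_of_half_def partitions_of_int_def by auto
qed

lemma crank_exp_ge: "crank_exp m r \<ge> r"
proof (cases r)
  case (Suc k)
  then have "2 * r \<le> r * (r + 1)" by simp
  then show ?thesis unfolding crank_exp_def by linarith
qed simp

theorem N_C1_diff_eq_crank_rank_sum: "N_C1 (int m) n - N_C1 (int m + 1) n = crank_rank_sum m n"
proof -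
  let ?h = "\<lambda>k. partitions_of_half (int n - int k)"
  have h0: "?h k = 0" if "k > n" for k using that by (simp add: partitions_of_half_def partitions_of_int_def)
  have h0': "partitions_of_half (int n - 2 * int (rank_exp m s)) = 0" if "n < 2 * s" for s
    using h0[of "2 * rank_exp m s"] rank_exp_ge[of s m] that by simp
  have "fps_nth (even_partition_gf n * (crank_rank_alpha r * fps_X ^ (r * (m + 1)))) n =
      (-1) ^ (r + 1) * ?h (crank_exp m r) + (if even r then (-1) ^ (r div 2) * ?h (2 * rank_exp m (r div 2)) else 0)"
     if "r \<in> {1..n}" for r
  proof -
    have c: "fps_nth (even_partition_gf n * ((-1) ^ i * fps_X ^ k)) n = (-1) ^ i * ?h k" for i k
      using even_partition_gf_mult_X_power_nth[of n k] by (cases "even i") auto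
    have e1: "r * (r - 1) div 2 + r * (m + 1) = crank_exp m r"
    proof -
      obtain k where k: "r = Suc k" using \<open>r \<in> {1..n}\<close> by (cases r) auto
      have "Suc k * (Suc k + 1) div 2 = Suc k * k div 2 + Suc k"
        using div_mult_self2[of 2 "Suc k * k" "Suc k"] by (simp add: algebra_simps)
      then show ?thesis unfolding k crank_exp_def by (simp add: algebra_simps)
    qed
    have e2: "r div 2 * (3 * (r div 2) - 1) + r * (m + 1) = 2 * rank_exp m (r div 2)" if "even r"
    proof -
      from \<open>even r\<close> obtain s where s: "r = 2 * s" by (auto elim: evenE)
      then obtain k where k: "s = Suc k" using \<open>r \<in> {1..n}\<close> by (cases s) auto
      have "even (s * (3 * s + 1))" by simp
      then have "2 * (s * (3 * s + 1) div 2) = s * (3 * s + 1)" by (rule dvd_mult_div_cancel)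
      then have "2 * rank_exp m s = s * (3 * s + 1) + 2 * (s * m)"
        unfolding rank_exp_def distrib_left by simp
      also have "\<dots> = s * (3 * s - 1) + r * (m + 1)" unfolding s k by (simp add: algebra_simps)
      finally show ?thesis using s by simp
    qed
    have "crank_rank_alpha r * fps_X ^ (r * (m + 1)) = (if even r then (-1) ^ (r div 2) * fps_X ^ (2 * rank_exp m (r div 2)) else 0)
             - (-1) ^ r * (fps_X ^ crank_exp m r :: int fps)"
    proof -
      have p1: "fps_X ^ (r * (r - 1) div 2) * fps_X ^ (r * (m + 1)) = (fps_X ^ crank_exp m r :: int fps)"
        unfolding e1[symmetric] by (rule power_add[symmetric])
      have p2: "fps_X ^ (r div 2 * (3 * (r div 2) - 1)) * fps_X ^ (r * (m + 1)) = (fps_X ^ (2 * rank_exp m (r div 2)) :: int fps)"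
        if "even r"
        unfolding e2[OF that, symmetric] by (rule power_add[symmetric])
      show ?thesis
        by (cases "even r") (simp_all only: crank_rank_alpha_def left_diff_distrib mult.assoc p1 p2 if_True if_False mult_zero_left)
    qed
    then show ?thesis by (auto simp: right_diff_distrib c)
  qed
  then have "N_C1 (int m) n - N_C1 (int m + 1) n =
     (\<Sum>r=1..n. (-1) ^ (r + 1) * ?h (crank_exp m r) + (if even r then (-1) ^ (r div 2) * ?h (2 * rank_exp m (r div 2)) else 0))"
    unfolding N_C1_diff_eq_coeff sum_distrib_left fps_sum_nth by (intro sum.cong refl)
  also have "\<dots> = (\<Sum>r=1..n. (-1) ^ (r + 1) * ?h (crank_exp m r)) + (\<Sum>s=1..n. (-1) ^ s * ?h (2 * rank_exp m s))"
    unfolding sum.distrib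
    by (subst sum_over_even) (auto simp: h0')
  also have "(\<Sum>r=1..n. (-1) ^ (r + 1) * ?h (crank_exp m r)) = (\<Sum>r=1..4*n. (-1) ^ (r + 1) * ?h (crank_exp m r))"
    by (rule sum.mono_neutral_left) (use h0 less_le_trans[OF _ crank_exp_ge] in auto)
  also have "(\<Sum>s=1..n. (-1) ^ s * ?h (2 * rank_exp m s)) = (\<Sum>s=1..4*n. (-1) ^ s * ?h (2 * rank_exp m s))"
  proof (rule sum.mono_neutral_left)
    show "\<forall>s\<in>{1..4*n} - {1..n}. (-1) ^ s * ?h (2 * rank_exp m s) = 0"
    proof
      fix s assume "s \<in> {1..4*n} - {1..n}"
      then have "2 * rank_exp m s > n" using rank_exp_ge[of s m] by auto
      then show "(-1) ^ s * ?h (2 * rank_exp m s) = 0" by (simp only: h0)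
    qed
  qed auto
  finally show ?thesis unfolding crank_rank_sum_def by simp
qed

theorem theorem1p3:
  fixes m :: nat
  shows "\<exists>n0::nat. \<forall>n\<ge>n0.
    (-1) ^ (m + n + 1) * (N_C1 (int m) n - N_C1 (int m + 1) n) > 0"
  unfolding N_C1_diff_eq_crank_rank_sum by (rule crank_rank_sum_sign)

end
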